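(* Let $\alpha\in(0,1)$, $T>0$, $r\ge1$. Let $0=t_0<t_1<\dots<t_N=T$ be a temporal mesh such that either $N=M$ and the mesh is quasi-graded with parameter $r$, or the mesh includes a submesh $\{t'_j\}_{j=0}^M$ of $[0,T]$ which is quasi-graded with parameter $r$ and has the same first mesh interval ($t'_1=t_1$). Let $u\in C[0,T]\cap C^2(0,T]$ satisfy $|\partial_t^l u(t)|\lesssim 1+t^{\alpha-l}$ for $l=1,2$ and $t\in(0,T]$, and suppose that $u$ and $\{U^m\}_{m=0}^N$ satisfy $$D_t^\alpha u(t)=f(t)\ \ \text{for } t\in(0,T],\quad u(0)=u_0,\qquad\qquad \delta_t^\alpha U^m=f(t_m)\ \ \text{for } m=1,\dots,N,\quad U^0=u_0 .$$ Then for all $m\ge1$ $$|u(t_m)-U^m|\lesssim\mathcal E^m:=\begin{cases}M^{-r}\,t_m^{\alpha-1}&\text{if }1\le r<2-\alpha,\\ M^{\alpha-2}\,t_m^{\alpha-1}\,[1+\ln(t_m/t_1)]&\text{if } r=2-\alpha,\\ M^{\alpha-2}\,t_m^{\alpha-(2-\alpha)/r}&\text{if } r>2-\alpha.\end{cases}$$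
   Context: Caputo derivative: $D_t^\alpha u(t):=\frac1{\Gamma(1-\alpha)}\int_0^t(t-s)^{-\alpha}\,\partial_su(s)\,ds$ for $0<t\le T$. L1 operator on the mesh $\{t_j\}_{j=0}^N$: for $m=1,\dots,N$, $$\delta_t^\alpha U^m:=\frac1{\Gamma(1-\alpha)}\sum_{j=1}^m\frac{U^j-U^{j-1}}{t_j-t_{j-1}}\int_{t_{j-1}}^{t_j}(t_m-s)^{-\alpha}\,ds.$$ A mesh $0=t_0<\dots<t_M=T$ is quasi-graded with parameter $r\ge1$ if, with $\tau:=t_1$, $$\tau\simeq M^{-r},\qquad t_j\simeq\tau j^r,\qquad \tau_j:=t_j-t_{j-1}\simeq\tau^{1/r}t_j^{1-1/r}\qquad\forall j=1,\dots,M.$$ Notation: $a\lesssim b$ means $a\le Cb$ with a generic constant $C>0$ that does not depend on the numbers of mesh intervals or on mesh indices (it may depend on fixed data such as $\alpha,T,r$, $u_0$, $f$ and on the constants implicit in the hypotheses); $a\simeq b$ means $a\lesssim b$ and $b\lesssim a$. *)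

theory Defs
  imports "HOL-Analysis.Analysis"
begin

text \<open>The integrand uses \<open>deriv u\<close>, the two-sided derivative, which is the classical derivative
  at every interior point of the range of integration; the two endpoints are a null set.\<close>

definition caputo :: "real \<Rightarrow> (real \<Rightarrow> real) \<Rightarrow> real \<Rightarrow> real" where
  "caputo \<alpha> u t =
     1 / Gamma (1 - \<alpha>) * integral {0..t} (\<lambda>s. (t - s) powr (- \<alpha>) * deriv u s)"

definition L1_op :: "real \<Rightarrow> (nat \<Rightarrow> real) \<Rightarrow> (nat \<Rightarrow> real) \<Rightarrow> nat \<Rightarrow> real" where
  "L1_op \<alpha> t U m =
     1 / Gamma (1 - \<alpha>) *
       (\<Sum>j=1..m. (U j - U (j - 1)) / (t j - t (j - 1)) *
          integral {t (j - 1)..t j} (\<lambda>s. (t m - s) powr (- \<alpha>)))"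

text \<open>Only the values \<open>t 0, \<dots>, t N\<close> of the sequence \<open>t\<close> are meaningful.\<close>

definition is_mesh :: "real \<Rightarrow> nat \<Rightarrow> (nat \<Rightarrow> real) \<Rightarrow> bool" where
  "is_mesh T N t \<longleftrightarrow> N \<ge> 1 \<and> t 0 = 0 \<and> (\<forall>j<N. t j < t (Suc j)) \<and> t N = T"

text \<open>The relation \<open>a \<simeq> b\<close> with its implicit constant \<open>K\<close> made explicit, so that
  uniformity over a family of meshes can be expressed.\<close>

definition simeq :: "real \<Rightarrow> real \<Rightarrow> real \<Rightarrow> bool" where
  "simeq K a b \<longleftrightarrow> a \<le> K * b \<and> b \<le> K * a"

definition quasi_graded :: "real \<Rightarrow> real \<Rightarrow> real \<Rightarrow> nat \<Rightarrow> (nat \<Rightarrow> real) \<Rightarrow> bool" where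
  "quasi_graded K T r M t \<longleftrightarrow>
     is_mesh T M t \<and>
     simeq K (t 1) (real M powr (- r)) \<and>
     (\<forall>j\<in>{1..M}.
        simeq K (t j) (t 1 * real j powr r) \<and>
        simeq K (t j - t (j - 1)) (t 1 powr (1 / r) * t j powr (1 - 1 / r)))"

definition admissible_mesh ::
    "real \<Rightarrow> real \<Rightarrow> real \<Rightarrow> nat \<Rightarrow> nat \<Rightarrow> (nat \<Rightarrow> real) \<Rightarrow> bool" where
  "admissible_mesh K T r M N t \<longleftrightarrow>
     is_mesh T N t \<and>
     (N = M \<and> quasi_graded K T r M t \<or>
      (\<exists>t'. quasi_graded K T r M t' \<and> t' ` {..M} \<subseteq> t ` {..N} \<and> t' 1 = t 1))"

text \<open>In the error bound \<open>t1\<close> is the first mesh node and \<open>tm\<close> the current one.\<close>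

definition err_bound :: "real \<Rightarrow> real \<Rightarrow> nat \<Rightarrow> real \<Rightarrow> real \<Rightarrow> real" where
  "err_bound \<alpha> r M t1 tm =
     (if r < 2 - \<alpha> then real M powr (- r) * tm powr (\<alpha> - 1)
      else if r = 2 - \<alpha> then real M powr (\<alpha> - 2) * tm powr (\<alpha> - 1) * (1 + ln (tm / t1))
      else real M powr (\<alpha> - 2) * tm powr (\<alpha> - (2 - \<alpha>) / r))"

end

theory Submission imports Defs begin


text \<open>
The error is bounded by consistency plus stability. Write $\tau = t_1$ and $e^m = u(t_m) - U^m$.
Then $\delta_t^\alpha e^m$ is the difference between the L1 operator and the Caputo derivative of
\<open>u\<close> at $t_m$.

\<^emph>\<open>Mesh.\<close> An admissible mesh enters through the two relations
$t_j - t_{j-1} \lesssim \tau^{1/r} t_{j-1}^{1-1/r}$ for $j \ge 2$ and $\tau \lesssim M^{-r}$. The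
first one passes from the quasi-graded submesh to every refinement with the same first interval
(\<open>admissible_mesh_graded\<close>).

\<^emph>\<open>Consistency.\<close> On each mesh interval an integration by parts moves the derivative from the
interpolation error \<open>w\<close> to the kernel, which leaves
$\int (t_m - s)^{-\alpha-1} |w(s)|\,ds$. On a strongly nonuniform refinement the standard bound
$|w| \lesssim (t_j - t_{j-1})^2$ is not enough: the next interval may be so short that the kernel is
almost singular at $t_j$. The cure is $|w(s)| \lesssim (t_j - t_{j-1})(t_j - s)$ together with
$t_j - s \le t_m - s$. It bounds the integrand by an expression in which the individual mesh intervals
no longer occur (\<open>error_density\<close>), and the consistency error is at most a multiple of
$(\tau/t_m)^p$ whenever $p \le (2-\alpha)/r$ and $p < 1 + \alpha$ (\<open>consistency_error\<close>).

\<^emph>\<open>Stability.\<close> The L1 operator satisfies a comparison principle on every mesh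
(\<open>l1_comparison\<close>), so $|e^m|$ is bounded by a multiple of any mesh function with zero initial value whose
L1 derivative is at least $(\tau/t_m)^p$. If $(2-\alpha)/r \le \alpha$, the nondecreasing function
$\tau^p t^{\alpha-p}$ will do. Otherwise the starting point is $t^{\alpha-1}$, whose Riemann-Liouville
derivative vanishes: replaced by the constant $\sigma^{\alpha-1}$ on $(0,\sigma]$, it acquires a
derivative of size $\sigma^\alpha t^{-\alpha-1}$ for $t > \sigma$. This derivative survives the
discretization when $\sigma$ is a mesh node and a large multiple of $\tau$, because the perturbation,
again bounded through \<open>error_density\<close>, is smaller by the factor $(\tau/\sigma)^\alpha$
(\<open>plateau_barrier_after\<close>). A superposition of these functions over the nodes
$\sigma = t_k$ of this kind, with weights $(t_k - t_{k-1}) (\tau/t_k)^p$, dominates $(\tau/t_m)^p$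
(\<open>stability\<close>). Its size is governed by $\tau^p t_m^{\alpha-1} \int_\tau^{t_m} s^{-p}\,ds$, and
the cases $p > 1$, $p = 1$, $p < 1$ of this integral are the three cases of the error bound.
\<close>

section \<open>The weights of the L1 operator and the comparison principle\<close>

lemma kernel_has_integral:
  fixes \<alpha> a b t :: real
  assumes "0 < \<alpha>" "\<alpha> < 1" "a \<le> b" "b \<le> t"
  shows "((\<lambda>s. (t - s) powr (-\<alpha>)) has_integral
           ((t - a) powr (1 - \<alpha>) - (t - b) powr (1 - \<alpha>)) / (1 - \<alpha>)) {a..b}"
proof -
  have "((\<lambda>s. (t - s) powr (-\<alpha>)) has_integral
      (- ((t - b) powr (1 - \<alpha>)) / (1 - \<alpha>)) - (- ((t - a) powr (1 - \<alpha>)) / (1 - \<alpha>))) {a..b}"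
  proof (rule fundamental_theorem_of_calculus_interior)
    show "continuous_on {a..b} (\<lambda>s. - ((t - s) powr (1 - \<alpha>)) / (1 - \<alpha>))"
      using assms by (intro continuous_intros continuous_on_powr') auto
    show "((\<lambda>s. - ((t - s) powr (1 - \<alpha>)) / (1 - \<alpha>)) has_vector_derivative (t - x) powr (-\<alpha>)) (at x)"
      if "x \<in> {a<..<b}" for x
      using that assms
      by (auto intro!: derivative_eq_intros simp flip: has_real_derivative_iff_has_vector_derivative)
  qed (use assms in auto)
  then show ?thesis by (simp add: diff_divide_distrib)
qed

lemma kernel_mean_value:
  fixes \<alpha> a b t :: real
  assumes "0 < \<alpha>" "\<alpha> < 1" "a < b" "b \<le> t"
  obtains \<xi> where "a < \<xi>" "\<xi> < b"
    "integral {a..b} (\<lambda>s. (t - s) powr (-\<alpha>)) / (b - a) = (t - \<xi>) powr (-\<alpha>)"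
proof -
  let ?F = "\<lambda>s. - ((t - s) powr (1 - \<alpha>)) / (1 - \<alpha>)"
  have "\<exists>l z. a < z \<and> z < b \<and> (?F has_real_derivative l) (at z) \<and> ?F b - ?F a = (b - a) * l"
  proof (rule MVT)
    show "continuous_on {a..b} ?F"
      using assms by (intro continuous_intros continuous_on_powr') auto
    show "?F differentiable (at x)" if "a < x" "x < b" for x
      unfolding real_differentiable_def
      by (rule exI[where x="(t - x) powr (-\<alpha>)"]) (use that assms in \<open>auto intro!: derivative_eq_intros\<close>)
  qed (use assms in auto)
  then obtain l z where z: "a < z" "z < b" "(?F has_real_derivative l) (at z)"
      "?F b - ?F a = (b - a) * l" by blast
  have "(?F has_real_derivative (t - z) powr (-\<alpha>)) (at z)"
    using z assms by (auto intro!: derivative_eq_intros)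
  then have l: "l = (t - z) powr (-\<alpha>)" using z(3) DERIV_unique by blast
  have "integral {a..b} (\<lambda>s. (t - s) powr (-\<alpha>)) = ?F b - ?F a"
    using kernel_has_integral[of \<alpha> a b t] assms
    by (simp add: integral_unique diff_divide_distrib)
  then have "integral {a..b} (\<lambda>s. (t - s) powr (-\<alpha>)) / (b - a) = (t - z) powr (-\<alpha>)"
    using z(4) l assms(3) by simp
  then show ?thesis using that z by blast
qed

definition l1_weight :: "real \<Rightarrow> (nat \<Rightarrow> real) \<Rightarrow> nat \<Rightarrow> nat \<Rightarrow> real" where
  "l1_weight \<alpha> t m j = integral {t (j - 1)..t j} (\<lambda>s. (t m - s) powr (-\<alpha>)) / (t j - t (j - 1))"

definition l1_sum :: "real \<Rightarrow> (nat \<Rightarrow> real) \<Rightarrow> (nat \<Rightarrow> real) \<Rightarrow> nat \<Rightarrow> real" where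
  "l1_sum \<alpha> t V m = (\<Sum>j=1..m. (V j - V (j - 1)) * l1_weight \<alpha> t m j)"

lemma L1_op_eq_l1_sum: "L1_op \<alpha> t V m = l1_sum \<alpha> t V m / Gamma (1 - \<alpha>)"
  by (simp add: L1_op_def l1_sum_def l1_weight_def)

lemma l1_sum_add: "l1_sum \<alpha> t (\<lambda>j. V j + W j) m = l1_sum \<alpha> t V m + l1_sum \<alpha> t W m"
  unfolding l1_sum_def sum.distrib[symmetric] by (rule sum.cong) (auto simp: algebra_simps)

lemma l1_sum_diff: "l1_sum \<alpha> t (\<lambda>j. V j - W j) m = l1_sum \<alpha> t V m - l1_sum \<alpha> t W m"
  unfolding l1_sum_def sum_subtractf[symmetric] by (rule sum.cong) (auto simp: algebra_simps)

lemma l1_sum_cmult: "l1_sum \<alpha> t (\<lambda>j. c * V j) m = c * l1_sum \<alpha> t V m"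
  unfolding l1_sum_def sum_distrib_left by (rule sum.cong) (auto simp: algebra_simps)

lemma l1_sum_sum: "finite A \<Longrightarrow>
    l1_sum \<alpha> t (\<lambda>j. \<Sum>k\<in>A. V k j) m = (\<Sum>k\<in>A. l1_sum \<alpha> t (V k) m)"
proof (induction A rule: finite_induct)
  case empty then show ?case by (simp add: l1_sum_def)
next
  case (insert x F) then show ?case by (simp add: l1_sum_add)
qed

lemma mesh_less:
  assumes "is_mesh T N t" "i < j" "j \<le> N"
  shows "t i < t j"
  using assms(2,3)
proof (induction j)
  case (Suc j)
  have "t j < t (Suc j)" using assms(1) Suc by (auto simp: is_mesh_def)
  then show ?case using Suc by (cases "i = j") auto
qed simp

lemma mesh_le: "is_mesh T N t \<Longrightarrow> i \<le> j \<Longrightarrow> j \<le> N \<Longrightarrow> t i \<le> t j"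
  using mesh_less[of T N t i j] by (cases "i = j") auto

lemma mesh_pos: "is_mesh T N t \<Longrightarrow> 1 \<le> j \<Longrightarrow> j \<le> N \<Longrightarrow> 0 < t j"
  using mesh_less[of T N t 0 j] by (auto simp: is_mesh_def)

lemma l1_weight_mean_value:
  assumes "0 < \<alpha>" "\<alpha> < 1" "is_mesh T N t" "1 \<le> j" "j \<le> m" "m \<le> N"
  obtains \<xi> where "t (j - 1) < \<xi>" "\<xi> < t j" "l1_weight \<alpha> t m j = (t m - \<xi>) powr (-\<alpha>)"
proof -
  have "t (j - 1) < t j" "t j \<le> t m"
    using mesh_less[of T N t "j - 1" j] mesh_le[of T N t j m] assms by auto
  from kernel_mean_value[OF assms(1,2) this] show ?thesis
    using that unfolding l1_weight_def by blast
qed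

lemma l1_weight_lower:
  assumes "0 < \<alpha>" "\<alpha> < 1" "is_mesh T N t" "1 \<le> j" "j \<le> m" "m \<le> N"
  shows "t m powr (-\<alpha>) \<le> l1_weight \<alpha> t m j"
proof -
  obtain \<xi> where \<xi>: "t (j - 1) < \<xi>" "\<xi> < t j" "l1_weight \<alpha> t m j = (t m - \<xi>) powr (-\<alpha>)"
    using l1_weight_mean_value[OF assms] .
  have "0 \<le> t (j - 1)"
    using mesh_le[of T N t 0 "j - 1"] assms by (auto simp: is_mesh_def)
  moreover have "t j \<le> t m" using mesh_le assms by blast
  ultimately show ?thesis unfolding \<xi>(3) using \<xi> assms by (intro powr_mono2') auto
qed

text \<open>The kernel increases towards \<open>t m\<close>, hence so do its means over successive mesh intervals. This is
the sign structure from which the comparison principle follows on every mesh.\<close>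

lemma l1_weight_mono:
  assumes "0 < \<alpha>" "\<alpha> < 1" "is_mesh T N t" "1 \<le> j" "j < m" "m \<le> N"
  shows "l1_weight \<alpha> t m j \<le> l1_weight \<alpha> t m (Suc j)"
proof -
  obtain \<xi> where \<xi>: "t (j - 1) < \<xi>" "\<xi> < t j" "l1_weight \<alpha> t m j = (t m - \<xi>) powr (-\<alpha>)"
    using l1_weight_mean_value[of \<alpha> T N t j m] assms by auto
  obtain \<eta> where \<eta>: "t j < \<eta>" "\<eta> < t (Suc j)" "l1_weight \<alpha> t m (Suc j) = (t m - \<eta>) powr (-\<alpha>)"
    using l1_weight_mean_value[of \<alpha> T N t "Suc j" m] assms by auto
  have "t (Suc j) \<le> t m" using mesh_le[of T N t "Suc j" m] assms by auto
  then show ?thesis unfolding \<xi>(3) \<eta>(3) using \<xi> \<eta> assms by (intro powr_mono2') auto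
qed

text \<open>After summation by parts the earlier values \<open>Z i\<close> enter with the coefficients
\<open>- (l1_weight \<alpha> t m (i + 1) - l1_weight \<alpha> t m i) \<le> 0\<close>, so they can only decrease the sum.\<close>

lemma l1_sum_le_last_weight:
  assumes "0 < \<alpha>" "\<alpha> < 1" "is_mesh T N t" "m \<le> N"
    and nn: "\<And>i. i < m \<Longrightarrow> 0 \<le> Z i" and "1 \<le> m"
  shows "l1_sum \<alpha> t Z m \<le> l1_weight \<alpha> t m m * Z m"
proof -
  let ?w = "l1_weight \<alpha> t m"
  have "n \<le> m \<Longrightarrow> 1 \<le> n \<Longrightarrow> (\<Sum>j=1..n. (Z j - Z (j - 1)) * ?w j) \<le> ?w n * Z n" for n
  proof (induction n)
    case (Suc n)
    show ?case
    proof (cases "n = 0")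
      case True
      have "0 \<le> ?w 1" using l1_weight_lower[of \<alpha> T N t 1 m] assms
        by (meson order_refl order_trans powr_ge_zero)
      moreover have "0 \<le> Z 0" using nn assms by auto
      ultimately show ?thesis using True by (simp add: algebra_simps)
    next
      case False
      then have "(\<Sum>j=1..Suc n. (Z j - Z (j - 1)) * ?w j) \<le> ?w n * Z n + (Z (Suc n) - Z n) * ?w (Suc n)"
        using Suc by simp
      also have "\<dots> = ?w (Suc n) * Z (Suc n) - (?w (Suc n) - ?w n) * Z n"
        by (simp add: algebra_simps)
      also have "\<dots> \<le> ?w (Suc n) * Z (Suc n)"
        using l1_weight_mono[of \<alpha> T N t n m] assms Suc.prems False nn[of n] by auto
      finally show ?thesis .
    qed
  qed simp
  then show ?thesis using assms by (auto simp: l1_sum_def)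
qed

lemma l1_nonneg:
  assumes "0 < \<alpha>" "\<alpha> < 1" "is_mesh T N t" "0 \<le> Z 0"
    and pos: "\<And>m. 1 \<le> m \<Longrightarrow> m \<le> N \<Longrightarrow> 0 \<le> l1_sum \<alpha> t Z m"
  shows "m \<le> N \<Longrightarrow> 0 \<le> Z m"
proof (induction m rule: less_induct)
  case (less m)
  show ?case
  proof (cases "m = 0")
    case False
    then have "0 \<le> l1_weight \<alpha> t m m * Z m"
      using order_trans[OF pos[of m] l1_sum_le_last_weight[OF assms(1-3)]] less by simp
    moreover have "0 < t m powr (-\<alpha>)" using mesh_pos[of T N t m] assms less False by auto
    then have "0 < l1_weight \<alpha> t m m"
      using less_le_trans[OF _ l1_weight_lower[OF assms(1-3)]] less False by simp
    ultimately show ?thesis by (simp add: zero_le_mult_iff)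
  qed (use assms in auto)
qed

text \<open>A mesh function \<open>B\<close> as here is called a barrier: bounding \<open>V\<close> is reduced to bounding the L1 operator
of an explicit function from below.\<close>

lemma l1_comparison:
  assumes "0 < \<alpha>" "\<alpha> < 1" "is_mesh T N t" "V 0 = 0" "B 0 = 0"
    and le: "\<And>m. 1 \<le> m \<Longrightarrow> m \<le> N \<Longrightarrow> \<bar>l1_sum \<alpha> t V m\<bar> \<le> l1_sum \<alpha> t B m"
    and "m \<le> N"
  shows "\<bar>V m\<bar> \<le> B m"
proof -
  have "0 \<le> B m - V m"
  proof (rule l1_nonneg[OF assms(1-3) _ _ \<open>m \<le> N\<close>])
    show "0 \<le> l1_sum \<alpha> t (\<lambda>j. B j - V j) n" if "1 \<le> n" "n \<le> N" for n
      unfolding l1_sum_diff using le[OF that] by linarith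
  qed (use assms in auto)
  moreover have "0 \<le> B m + V m"
  proof (rule l1_nonneg[OF assms(1-3) _ _ \<open>m \<le> N\<close>])
    show "0 \<le> l1_sum \<alpha> t (\<lambda>j. B j + V j) n" if "1 \<le> n" "n \<le> N" for n
      unfolding l1_sum_add using le[OF that] by linarith
  qed (use assms in auto)
  ultimately show ?thesis by linarith
qed

text \<open>All increments are nonnegative and every weight is at least its smallest possible value
\<open>t m powr (-\<alpha>)\<close>.\<close>

lemma l1_sum_monotone_lower:
  assumes "0 < \<alpha>" "\<alpha> < 1" "is_mesh T N t" "m \<le> N"
    and mono: "\<And>j. 1 \<le> j \<Longrightarrow> j \<le> m \<Longrightarrow> B (j - 1) \<le> B j"
  shows "t m powr (-\<alpha>) * (B m - B 0) \<le> l1_sum \<alpha> t B m"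
proof -
  have "B m - B 0 = (\<Sum>j=1..m. B j - B (j - 1))"
    by (induction m) auto
  then have "t m powr (-\<alpha>) * (B m - B 0) = (\<Sum>j=1..m. (B j - B (j - 1)) * t m powr (-\<alpha>))"
    by (simp add: sum_distrib_left mult.commute)
  also have "\<dots> \<le> l1_sum \<alpha> t B m"
    unfolding l1_sum_def
    using assms l1_weight_lower[of \<alpha> T N t _ m]
    by (intro sum_mono mult_left_mono) auto
  finally show ?thesis .
qed

section \<open>Consistency on one mesh interval\<close>

text \<open>Integration by parts for the product of the kernel and \<open>w\<close>, whose boundary terms vanish with \<open>w\<close>. When
\<open>b = t\<close> the kernel is singular at the endpoint, and the linear decay of \<open>w\<close> towards \<open>b\<close> makes the
product continuous there. The integrability of the new integrand comes from the fundamental theorem of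
calculus for the gauge integral.\<close>

lemma abs_integral_kernel_derivative_le:
  fixes \<alpha> a b t D :: real and w w' \<Phi> :: "real \<Rightarrow> real"
  assumes \<alpha>: "0 < \<alpha>" "\<alpha> < 1" and ab: "a < b" "b \<le> t"
    and cont: "continuous_on {a..b} w" and w0: "w a = 0" "w b = 0"
    and deriv: "\<And>s. s \<in> {a<..<b} \<Longrightarrow> (w has_real_derivative w' s) (at s)"
    and lip: "\<And>s. s \<in> {a..b} \<Longrightarrow> \<bar>w s\<bar> \<le> D * (b - s)"
    and int: "(\<lambda>s. (t - s) powr (-\<alpha>) * w' s) integrable_on {a..b}"
    and \<Phi>: "\<Phi> integrable_on {a..b}" "\<And>s. s \<in> {a..b} \<Longrightarrow> 0 \<le> \<Phi> s"
    and dom: "\<And>s. s \<in> {a<..<b} \<Longrightarrow> (t - s) powr (-\<alpha> - 1) * \<bar>w s\<bar> \<le> \<Phi> s"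
  shows "\<bar>integral {a..b} (\<lambda>s. (t - s) powr (-\<alpha>) * w' s)\<bar> \<le> \<alpha> * integral {a..b} \<Phi>"
proof -
  let ?H = "\<lambda>s. (t - s) powr (-\<alpha>) * w s"
  let ?P = "\<lambda>s. (t - s) powr (-\<alpha>) * w' s" and ?Q = "\<lambda>s. \<alpha> * ((t - s) powr (-\<alpha> - 1) * w s)"
  have contH: "continuous_on {a..b} ?H"
  proof (cases "b = t")
    case False
    then show ?thesis using cont ab by (intro continuous_intros cont) auto
  next
    case True
    have "continuous (at s within {a..b}) ?H" if s: "s \<in> {a..b}" for s
    proof (cases "s = b")
      case False
      have "continuous (at s within {a..b}) w"
        using cont s by (auto simp: continuous_on_eq_continuous_within)
      then show ?thesis using False s ab True by (intro continuous_intros) auto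
    next
      case sb: True
      have "((\<lambda>s. D * (t - s) powr (1 - \<alpha>)) \<longlongrightarrow> D * (t - b) powr (1 - \<alpha>)) (at b within {a..b})"
        using \<alpha> True by (intro tendsto_intros) (auto simp: eventually_at_filter)
      then have lim: "((\<lambda>s. D * (t - s) powr (1 - \<alpha>)) \<longlongrightarrow> 0) (at b within {a..b})"
        using True by simp
      have "((\<lambda>s. ?H s) \<longlongrightarrow> 0) (at b within {a..b})"
      proof (rule Lim_null_comparison[OF _ lim])
        show "\<forall>\<^sub>F s in at b within {a..b}. norm (?H s) \<le> D * (t - s) powr (1 - \<alpha>)"
          unfolding eventually_at_filter
        proof (intro always_eventually allI impI)
          fix s assume s: "s \<noteq> b" "s \<in> {a..b}"
          then have "norm (?H s) \<le> (t - s) powr (-\<alpha>) * (D * (b - s))"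
            using lip[OF s(2)] by (simp add: abs_mult mult_left_mono)
          also have "\<dots> = D * ((t - s) powr (-\<alpha>) * (t - s))"
            using True by (simp add: mult_ac)
          also have "(t - s) powr (-\<alpha>) * (t - s) = (t - s) powr (1 - \<alpha>)"
            using powr_mult_base[of "t - s" "-\<alpha>"] s True by (simp add: mult.commute)
          finally show "norm (?H s) \<le> D * (t - s) powr (1 - \<alpha>)" .
        qed
      qed
      then show ?thesis using sb True w0 by (simp add: continuous_within)
    qed
    then show ?thesis by (simp add: continuous_on_eq_continuous_within)
  qed
  have "((\<lambda>s. ?P s + ?Q s) has_integral ?H b - ?H a) {a..b}"
  proof (rule fundamental_theorem_of_calculus_interior[OF _ contH])
    show "(?H has_vector_derivative (?P x + ?Q x)) (at x)" if x: "x \<in> {a<..<b}" for x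
      unfolding has_real_derivative_iff_has_vector_derivative[symmetric]
      using x ab by (auto intro!: derivative_eq_intros deriv simp: algebra_simps)
  qed (use ab in auto)
  then have H: "((\<lambda>s. ?P s + ?Q s) has_integral 0) {a..b}" using w0 by simp
  have P: "(?P has_integral integral {a..b} ?P) {a..b}" using int by blast
  have Q: "(?Q has_integral - integral {a..b} ?P) {a..b}"
    using has_integral_diff[OF H P] by simp
  have "norm (integral {a..b} ?Q) \<le> integral {a..b} (\<lambda>s. \<alpha> * \<Phi> s)"
  proof (rule integral_norm_bound_integral)
    show "norm (?Q s) \<le> \<alpha> * \<Phi> s" if s: "s \<in> {a..b}" for s
    proof (cases "s \<in> {a<..<b}")
      case True then show ?thesis using dom[OF True] \<alpha> by (simp add: abs_mult)
    next
      case False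
      then have "s = a \<or> s = b" using s by auto
      then show ?thesis using w0 \<Phi>(2)[OF s] \<alpha> by auto
    qed
    show "(\<lambda>s. \<alpha> * \<Phi> s) integrable_on {a..b}" using \<Phi>(1) by (rule integrable_on_mult_right)
  qed (use Q in blast)
  moreover have "integral {a..b} ?Q = - integral {a..b} ?P"
    using Q by (rule integral_unique)
  ultimately show ?thesis unfolding integral_mult_right by simp
qed

text \<open>The bound is linear in \<open>b - s\<close>: this decay towards the right endpoint is what compensates for a
kernel singularity at, or close to, the right of \<open>b\<close>. Two applications of the mean value theorem give
it, since the chord slope equals \<open>v' \<eta>\<close> for some \<open>\<eta>\<close> and the error is \<open>(v' \<xi> - v' \<eta>) * (b - s)\<close>
up to sign.\<close>

lemma linear_interpolation_error:
  fixes v v' v'' :: "real \<Rightarrow> real" and a b D :: real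
  assumes ab: "a < b" and cont: "continuous_on {a..b} v"
    and d1: "\<And>s. s \<in> {a<..<b} \<Longrightarrow> (v has_real_derivative v' s) (at s)"
    and d2: "\<And>s. s \<in> {a<..<b} \<Longrightarrow> (v' has_real_derivative v'' s) (at s)"
    and bd: "\<And>s. s \<in> {a<..<b} \<Longrightarrow> \<bar>v'' s\<bar> \<le> D"
    and s: "s \<in> {a..b}"
  shows "\<bar>v s - (v a + (v b - v a) / (b - a) * (s - a))\<bar> \<le> D * (b - a) * (b - s)"
proof (cases "s = b")
  case True then show ?thesis using ab by simp
next
  case False
  define c where "c = (v b - v a) / (b - a)"
  have der: "v differentiable (at x)" if "a < x" "x < b" for x
    using d1[of x] that by (auto simp: real_differentiable_def)
  obtain l \<eta> where \<eta>: "a < \<eta>" "\<eta> < b" "(v has_real_derivative l) (at \<eta>)" "v b - v a = (b - a) * l"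
    using MVT[OF ab cont der] by blast
  have l: "l = c" "v' \<eta> = c"
  proof -
    show "l = c" unfolding c_def \<eta>(4) using ab by simp
    have "l = v' \<eta>" by (rule DERIV_unique[OF \<eta>(3) d1]) (use \<eta>(1,2) in simp)
    with \<open>l = c\<close> show "v' \<eta> = c" by simp
  qed
  have sb: "s < b" using s False by auto
  have "continuous_on {s..b} v" using cont by (rule continuous_on_subset) (use s in auto)
  moreover have "v differentiable (at x)" if "s < x" "x < b" for x
    using der[of x] that s by auto
  ultimately obtain l' \<xi> where \<xi>: "s < \<xi>" "\<xi> < b" "(v has_real_derivative l') (at \<xi>)" "v b - v s = (b - s) * l'"
    using MVT[OF sb] by blast
  have l': "l' = v' \<xi>" by (rule DERIV_unique[OF \<xi>(3) d1]) (use \<xi>(1,2) s in auto)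
  have D0: "0 \<le> D" using bd[of \<eta>] \<eta> by auto
  have "\<bar>v' \<xi> - v' \<eta>\<bar> \<le> D * \<bar>\<xi> - \<eta>\<bar>"
  proof -
    have "norm (v' \<xi> - v' \<eta>) \<le> D * norm (\<xi> - \<eta>)"
      by (rule field_differentiable_bound[of "{a<..<b}" v' v''])
        (use bd d2 \<xi> \<eta> s in \<open>auto intro: has_field_derivative_at_within\<close>)
    then show ?thesis by simp
  qed
  also have "\<dots> \<le> D * (b - a)" using \<xi> \<eta> s D0 by (intro mult_left_mono) auto
  finally have diff: "\<bar>v' \<xi> - c\<bar> \<le> D * (b - a)" using l by simp
  have cb: "c * (b - a) = v b - v a" using ab by (simp add: c_def)
  have "v s - (v a + c * (s - a)) = v b - (b - s) * v' \<xi> - (v b - c * (b - a)) - c * (s - a)"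
    unfolding cb \<xi>(4)[unfolded l', symmetric] by simp
  also have "\<dots> = - ((v' \<xi> - c) * (b - s))" by (simp add: algebra_simps)
  finally have "\<bar>v s - (v a + c * (s - a))\<bar> = \<bar>v' \<xi> - c\<bar> * (b - s)"
    using sb by (simp add: abs_mult)
  also have "\<dots> \<le> D * (b - a) * (b - s)" using diff sb by (intro mult_right_mono) auto
  finally show ?thesis by (simp add: c_def)
qed


section \<open>Integrals that dominate the consistency error on a graded mesh\<close>

text \<open>The truncation at \<open>\<delta>\<close> splits the integral at distance \<open>\<delta>\<close> from \<open>t\<close>; both parts are of the order
\<open>\<delta> powr (1 - \<alpha>)\<close>, one being controlled by integrability of the kernel itself and the other by the
decay of its derivative.\<close>

lemma truncated_kernel_integral:
  fixes \<alpha> a t \<delta> :: real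
  assumes \<alpha>: "0 < \<alpha>" "\<alpha> < 1" and "a \<le> t" "0 < \<delta>"
  shows "(\<lambda>s. (t - s) powr (-\<alpha> - 1) * min \<delta> (t - s)) integrable_on {a..t}" (is "?k integrable_on _")
    and "integral {a..t} (\<lambda>s. (t - s) powr (-\<alpha> - 1) * min \<delta> (t - s))
           \<le> (1 / \<alpha> + 1 / (1 - \<alpha>)) * \<delta> powr (1 - \<alpha>)"
proof -
  \<comment> \<open>The two branches of the antiderivative are glued by \<open>max\<close> and \<open>min\<close>, which makes continuity at
      \<open>t - \<delta>\<close> automatic.\<close>
  define F where "F = (\<lambda>s. \<delta> * max (t - s) \<delta> powr (-\<alpha>) / \<alpha> - min (t - s) \<delta> powr (1 - \<alpha>) / (1 - \<alpha>))"
  have *: "(?k has_integral F t - F a) {a..t}"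
  proof (rule fundamental_theorem_of_calculus_interior_strong[of "{t - \<delta>}"])
    show "continuous_on {a..t} F"
      unfolding F_def using assms by (intro continuous_intros continuous_on_powr') auto
    show "(F has_vector_derivative ?k x) (at x)" if x: "x \<in> {a<..<t} - {t - \<delta>}" for x
    proof (cases "t - x > \<delta>")
      case True
      have "(F has_real_derivative \<delta> * (t - x) powr (-\<alpha> - 1)) (at x)"
      proof (rule has_field_derivative_transform_within_open)
        show "((\<lambda>s. \<delta> * (t - s) powr (-\<alpha>) / \<alpha> - \<delta> powr (1 - \<alpha>) / (1 - \<alpha>))
            has_real_derivative \<delta> * (t - x) powr (-\<alpha> - 1)) (at x)"
          using x \<alpha> by (auto intro!: derivative_eq_intros)
        show "x \<in> {..<t - \<delta>}" using True by auto
      qed (use assms in \<open>auto simp: F_def max_def min_def\<close>)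
      then show ?thesis using True
        by (simp add: mult.commute flip: has_real_derivative_iff_has_vector_derivative)
    next
      case False
      have lt: "t - x < \<delta>" using False x by auto
      have "(F has_real_derivative (t - x) powr (-\<alpha>)) (at x)"
      proof (rule has_field_derivative_transform_within_open)
        show "((\<lambda>s. \<delta> * \<delta> powr (-\<alpha>) / \<alpha> - (t - s) powr (1 - \<alpha>) / (1 - \<alpha>))
            has_real_derivative (t - x) powr (-\<alpha>)) (at x)"
          using x \<alpha> by (auto intro!: derivative_eq_intros)
        show "x \<in> {t - \<delta><..}" using lt by auto
      qed (use assms in \<open>auto simp: F_def max_def min_def\<close>)
      moreover have "(t - x) powr (-\<alpha>) = ?k x"
        using powr_mult_base[of "t - x" "-\<alpha> - 1"] x lt by (simp add: mult.commute)
      ultimately show ?thesis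
        by (simp flip: has_real_derivative_iff_has_vector_derivative)
    qed
  qed (use assms in auto)
  then show "?k integrable_on {a..t}" by blast
  have 1: "\<delta> * \<delta> powr (-\<alpha>) = \<delta> powr (1 - \<alpha>)"
    using powr_mult_base[of \<delta> "-\<alpha>"] assms by simp
  have "min (t - a) \<delta> powr (1 - \<alpha>) \<le> \<delta> powr (1 - \<alpha>)"
    using assms by (intro powr_mono2) auto
  then have 2: "min (t - a) \<delta> powr (1 - \<alpha>) / (1 - \<alpha>) \<le> \<delta> powr (1 - \<alpha>) / (1 - \<alpha>)"
    using \<alpha> by (simp add: divide_right_mono)
  have 3: "0 \<le> \<delta> * max (t - a) \<delta> powr (-\<alpha>) / \<alpha>" using assms by simp
  have "F t - F a \<le> \<delta> powr (1 - \<alpha>) / \<alpha> + \<delta> powr (1 - \<alpha>) / (1 - \<alpha>)"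
  proof -
    have "F t = \<delta> powr (1 - \<alpha>) / \<alpha>" using assms by (simp add: F_def flip: 1)
    then show ?thesis using 2 3 unfolding F_def by linarith
  qed
  then show "integral {a..t} ?k \<le> (1 / \<alpha> + 1 / (1 - \<alpha>)) * \<delta> powr (1 - \<alpha>)"
    using * by (simp add: integral_unique algebra_simps)
qed

text \<open>The local mesh width at \<open>s\<close> that grading with exponent \<open>r\<close> and first step \<open>\<tau>\<close> prescribes; it equals \<open>\<tau>\<close>
at \<open>s = \<tau>\<close>.\<close>

definition graded_step :: "real \<Rightarrow> real \<Rightarrow> real \<Rightarrow> real" where
  "graded_step r \<tau> s = \<tau> powr (1 / r) * s powr (1 - 1 / r)"

lemma graded_step_pos: "0 < \<tau> \<Longrightarrow> 0 < s \<Longrightarrow> 0 < graded_step r \<tau> s"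
  by (simp add: graded_step_def)

lemma graded_step_mono:
  "1 \<le> r \<Longrightarrow> 0 < s \<Longrightarrow> s \<le> s' \<Longrightarrow> graded_step r \<tau> s \<le> graded_step r \<tau> s'"
  unfolding graded_step_def by (intro mult_left_mono powr_mono2) auto

lemma graded_step_powr:
  "0 < \<tau> \<Longrightarrow> 0 < s \<Longrightarrow> graded_step r \<tau> s powr q = \<tau> powr (q / r) * s powr (q - q / r)"
  by (simp add: graded_step_def powr_mult powr_powr algebra_simps)

lemma graded_step_le:
  assumes "1 \<le> r" "0 < \<tau>" "\<tau> \<le> s"
  shows "graded_step r \<tau> s \<le> s"
proof -
  have "graded_step r \<tau> s \<le> s powr (1 / r) * s powr (1 - 1 / r)"
    unfolding graded_step_def using assms by (intro mult_right_mono powr_mono2) auto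
  then show ?thesis using assms by (simp flip: powr_add)
qed

text \<open>A majorant of \<open>(t - s) powr (-\<alpha> - 1)\<close> times the interpolation error of a function whose second
derivative behaves like \<open>h powr (\<nu> - 2)\<close>, where \<open>h\<close> is the point at which the mesh width is taken: \<open>h = s\<close>
away from the origin and \<open>h = \<tau>\<close> on the first interval. The first summand controls \<open>s \<le> t / 2\<close>, where
the kernel is harmless, and the second controls \<open>s > t / 2\<close>, where mesh width and solution are
comparable with their values at \<open>t\<close>. Adding the two avoids splitting integrals at \<open>t / 2\<close>, which need not
be a mesh node.\<close>

definition error_density :: "real \<Rightarrow> real \<Rightarrow> real \<Rightarrow> real \<Rightarrow> real \<Rightarrow> real \<Rightarrow> real \<Rightarrow> real" where
  "error_density \<alpha> r \<tau> \<nu> t h s =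
     t powr (-\<alpha> - 1) * (\<tau> powr (2 / r) * h powr (\<nu> - 2 / r)) +
     t powr (\<nu> - 2) * graded_step r \<tau> t * ((t - s) powr (-\<alpha> - 1) * min (graded_step r \<tau> t) (t - s))"

text \<open>The exponents that occur lie between \<open>-3\<close> and \<open>0\<close>, so one constant serves throughout.\<close>

lemma powr_half_le:
  fixes x y q :: real
  assumes "0 < y" "y / 2 \<le> x" "-3 \<le> q" "q \<le> 0"
  shows "x powr q \<le> 8 * y powr q"
proof -
  have "x powr q \<le> (y / 2) powr q" using assms by (intro powr_mono2') auto
  also have "\<dots> = 2 powr (- q) * y powr q"
    using assms by (simp add: powr_divide powr_minus field_simps)
  also have "\<dots> \<le> 2 powr 3 * y powr q"
    using assms by (intro mult_right_mono powr_mono) auto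
  finally show ?thesis by simp
qed

lemma kernel_graded_error_le:
  fixes \<alpha> r \<tau> \<nu> t h s :: real
  assumes \<alpha>: "0 < \<alpha>" "\<alpha> < 1" and r: "1 \<le> r" and \<tau>: "0 < \<tau>" "\<tau> \<le> h"
    and s: "0 \<le> s" "s < t" "s \<le> h" "h \<le> t" and \<nu>: "-1 \<le> \<nu>" "\<nu> \<le> 1"
  shows "(t - s) powr (-\<alpha> - 1) * (graded_step r \<tau> h * min (graded_step r \<tau> h) (t - s) * h powr (\<nu> - 2))
           \<le> 8 * error_density \<alpha> r \<tau> \<nu> t h s"
proof -
  let ?g = "graded_step r \<tau>"
  have h: "0 < h" "0 < t" using \<tau> s by auto
  have pos: "0 < ?g h" "0 < ?g t" using graded_step_pos \<tau> h by auto
  have t1: "0 \<le> t powr (-\<alpha> - 1) * (\<tau> powr (2 / r) * h powr (\<nu> - 2 / r))" by simp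
  have t2: "0 \<le> t powr (\<nu> - 2) * ?g t * ((t - s) powr (-\<alpha> - 1) * min (?g t) (t - s))"
    using pos s by simp
  show ?thesis
  proof (cases "s \<le> t / 2")
    case True
    have "(t - s) powr (-\<alpha> - 1) \<le> 8 * t powr (-\<alpha> - 1)"
      using True h \<alpha> by (intro powr_half_le) auto
    moreover have "?g h * min (?g h) (t - s) * h powr (\<nu> - 2) \<le> ?g h * ?g h * h powr (\<nu> - 2)"
      using pos by (intro mult_right_mono mult_left_mono) auto
    ultimately have "(t - s) powr (-\<alpha> - 1) * (?g h * min (?g h) (t - s) * h powr (\<nu> - 2))
        \<le> (8 * t powr (-\<alpha> - 1)) * (?g h * ?g h * h powr (\<nu> - 2))"
      using pos s by (intro mult_mono) auto
    also have "?g h * ?g h = \<tau> powr (2 / r) * h powr (2 - 2 / r)"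
      using graded_step_powr[of \<tau> h r 2] \<tau> h pos by (simp add: power2_eq_square)
    also have "\<tau> powr (2 / r) * h powr (2 - 2 / r) * h powr (\<nu> - 2) = \<tau> powr (2 / r) * h powr (\<nu> - 2 / r)"
      by (simp add: mult.assoc flip: powr_add)
    finally show ?thesis using t2 unfolding error_density_def by (simp add: algebra_simps)
  next
    case False
    have "h powr (\<nu> - 2) \<le> 8 * t powr (\<nu> - 2)"
      using False s h \<nu> by (intro powr_half_le) auto
    moreover have g: "?g h \<le> ?g t" using graded_step_mono r h s by simp
    ultimately have "?g h * min (?g h) (t - s) * h powr (\<nu> - 2)
        \<le> ?g t * min (?g t) (t - s) * (8 * t powr (\<nu> - 2))"
      using pos s by (intro mult_mono) auto
    then have "(t - s) powr (-\<alpha> - 1) * (?g h * min (?g h) (t - s) * h powr (\<nu> - 2))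
        \<le> (t - s) powr (-\<alpha> - 1) * (?g t * min (?g t) (t - s) * (8 * t powr (\<nu> - 2)))"
      by (intro mult_left_mono) auto
    also have "\<dots> = 8 * (t powr (\<nu> - 2) * ?g t * ((t - s) powr (-\<alpha> - 1) * min (?g t) (t - s)))"
      by (simp add: mult_ac)
    finally show ?thesis using t1 unfolding error_density_def distrib_left by linarith
  qed
qed

lemma error_density_nonneg:
  assumes "0 < \<tau>" "0 < t" "s \<le> t"
  shows "0 \<le> error_density \<alpha> r \<tau> \<nu> t h s"
  using assms graded_step_pos[of \<tau> t r] unfolding error_density_def by simp

lemma near_part_integral:
  fixes \<alpha> r \<tau> \<nu> t a :: real
  assumes \<alpha>: "0 < \<alpha>" "\<alpha> < 1" and \<tau>: "0 < \<tau>" "0 < t" "a \<le> t"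
  defines "k \<equiv> (\<lambda>s. t powr (\<nu> - 2) * graded_step r \<tau> t *
                   ((t - s) powr (-\<alpha> - 1) * min (graded_step r \<tau> t) (t - s)))"
  shows "k integrable_on {a..t}"
    and "integral {a..t} k \<le> (1 / \<alpha> + 1 / (1 - \<alpha>)) *
           (\<tau> powr ((2 - \<alpha>) / r) * t powr (\<nu> - \<alpha> - (2 - \<alpha>) / r))"
proof -
  let ?g = "graded_step r \<tau> t" and ?c = "1 / \<alpha> + 1 / (1 - \<alpha>)"
  have g: "0 < ?g" using graded_step_pos \<tau> by simp
  note K = truncated_kernel_integral[OF \<alpha> \<tau>(3) g]
  show "k integrable_on {a..t}" unfolding k_def by (rule integrable_on_mult_right[OF K(1)])
  have "integral {a..t} k \<le> t powr (\<nu> - 2) * ?g * (?c * ?g powr (1 - \<alpha>))"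
    unfolding k_def integral_mult_right using K(2) g by (intro mult_left_mono) auto
  also have "\<dots> = ?c * t powr (\<nu> - 2) * (?g * ?g powr (1 - \<alpha>))" by simp
  also have "?g * ?g powr (1 - \<alpha>) = ?g powr (2 - \<alpha>)"
    using powr_mult_base[of ?g "1 - \<alpha>"] g by simp
  also have "\<dots> = \<tau> powr ((2 - \<alpha>) / r) * t powr (2 - \<alpha> - (2 - \<alpha>) / r)"
    using graded_step_powr \<tau> by simp
  also have "?c * t powr (\<nu> - 2) * (\<tau> powr ((2 - \<alpha>) / r) * t powr (2 - \<alpha> - (2 - \<alpha>) / r))
      = ?c * (\<tau> powr ((2 - \<alpha>) / r) * (t powr (\<nu> - 2) * t powr (2 - \<alpha> - (2 - \<alpha>) / r)))" by simp
  also have "t powr (\<nu> - 2) * t powr (2 - \<alpha> - (2 - \<alpha>) / r) = t powr (\<nu> - \<alpha> - (2 - \<alpha>) / r)"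
    by (simp add: algebra_simps flip: powr_add)
  finally show "integral {a..t} k \<le> ?c * (\<tau> powr ((2 - \<alpha>) / r) * t powr (\<nu> - \<alpha> - (2 - \<alpha>) / r))" .
qed

lemma powr_has_integral_pos:
  fixes q a b :: real
  assumes "0 < a" "a \<le> b" "q \<noteq> -1"
  shows "((\<lambda>s. s powr q) has_integral (b powr (q + 1) - a powr (q + 1)) / (q + 1)) {a..b}"
proof -
  have "((\<lambda>s. s powr q) has_integral b powr (q + 1) / (q + 1) - a powr (q + 1) / (q + 1)) {a..b}"
    using assms by (intro fundamental_theorem_of_calculus)
      (auto intro!: derivative_eq_intros simp: simp flip: has_real_derivative_iff_has_vector_derivative)
  then show ?thesis by (simp add: diff_divide_distrib)
qed

lemma error_density_integrable:
  assumes \<alpha>: "0 < \<alpha>" "\<alpha> < 1" and "0 < \<tau>" "0 < a" "a \<le> b" "b \<le> t"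
  shows "(\<lambda>s. error_density \<alpha> r \<tau> \<nu> t s s) integrable_on {a..b}"
proof -
  have "(\<lambda>s. error_density \<alpha> r \<tau> \<nu> t s s) integrable_on {a..t}"
    unfolding error_density_def using assms
    by (intro integrable_add near_part_integral(1)) (auto intro!: integrable_continuous_real continuous_intros)
  then show ?thesis by (rule integrable_on_subinterval) (use assms in auto)
qed

lemma error_density_integral_le:
  assumes \<alpha>: "0 < \<alpha>" "\<alpha> < 1" and "0 < \<tau>" "0 < a" "a \<le> t"
  shows "integral {a..t} (\<lambda>s. error_density \<alpha> r \<tau> \<nu> t s s)
    \<le> t powr (-\<alpha> - 1) * integral {a..t} (\<lambda>s. \<tau> powr (2 / r) * s powr (\<nu> - 2 / r))
      + (1 / \<alpha> + 1 / (1 - \<alpha>)) * (\<tau> powr ((2 - \<alpha>) / r) * t powr (\<nu> - \<alpha> - (2 - \<alpha>) / r))"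
proof -
  have i: "(\<lambda>s. t powr (-\<alpha> - 1) * (\<tau> powr (2 / r) * s powr (\<nu> - 2 / r))) integrable_on {a..t}"
    using assms by (auto intro!: integrable_continuous_real continuous_intros)
  have "0 < t" using assms by simp
  note n = near_part_integral[OF \<alpha> \<open>0 < \<tau>\<close> this \<open>a \<le> t\<close>, of \<nu> r]
  show ?thesis
    unfolding error_density_def
    using n(2) by (subst integral_add[OF i n(1)]) (simp add: mult.assoc)
qed

text \<open>One mesh interval away from the origin. It is applied twice: to the solution with \<open>\<nu> = \<alpha>\<close>, and to
the barrier \<open>\<lambda>s. s powr (\<alpha> - 1)\<close> with \<open>\<nu> = \<alpha> - 1\<close>. Since \<open>a \<ge> \<tau>\<close>, the width condition also gives
\<open>b \<le> (1 + L) * a\<close>, so powers of \<open>a\<close> and of \<open>s\<close> are interchangeable on the interval.\<close>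

lemma smooth_interval_error:
  fixes \<alpha> r \<tau> \<nu> t a b L D :: real and v v' v'' :: "real \<Rightarrow> real"
  assumes \<alpha>: "0 < \<alpha>" "\<alpha> < 1" and r: "1 \<le> r" and \<tau>: "0 < \<tau>" "\<tau> \<le> a"
    and ab: "a < b" "b \<le> t" and L: "1 \<le> L" "b - a \<le> L * graded_step r \<tau> a"
    and \<nu>: "-1 \<le> \<nu>" "\<nu> \<le> 1"
    and cont: "continuous_on {a..b} v"
    and d1: "\<And>s. s \<in> {a<..<b} \<Longrightarrow> (v has_real_derivative v' s) (at s)"
    and d2: "\<And>s. s \<in> {a<..<b} \<Longrightarrow> (v' has_real_derivative v'' s) (at s)"
    and bd: "\<And>s. s \<in> {a<..<b} \<Longrightarrow> \<bar>v'' s\<bar> \<le> D * s powr (\<nu> - 2)"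
    and int: "(\<lambda>s. (t - s) powr (-\<alpha>) * v' s) integrable_on {a..b}"
  shows "\<bar>(v b - v a) / (b - a) * integral {a..b} (\<lambda>s. (t - s) powr (-\<alpha>))
            - integral {a..b} (\<lambda>s. (t - s) powr (-\<alpha>) * v' s)\<bar>
         \<le> 8 * D * L\<^sup>2 * (1 + L) ^ 3 * integral {a..b} (\<lambda>s. error_density \<alpha> r \<tau> \<nu> t s s)"
proof -
  let ?g = "graded_step r \<tau>" and ?c = "(v b - v a) / (b - a)"
  let ?E = "\<lambda>s. error_density \<alpha> r \<tau> \<nu> t s s"
  define w where "w = (\<lambda>s. v s - (v a + ?c * (s - a)))"
  define A where "A = D * L\<^sup>2 * (1 + L) ^ 3"
  have a0: "0 < a" using \<tau> by simp
  have D: "0 \<le> D"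
  proof -
    have "0 \<le> D * ((a + b) / 2) powr (\<nu> - 2)"
      using bd[of "(a + b) / 2"] ab by force
    then show ?thesis using a0 ab by (simp add: zero_le_mult_iff)
  qed
  have A: "0 \<le> A" using D L by (simp add: A_def)
  have b_le: "b \<le> (1 + L) * a"
  proof -
    have "L * ?g a \<le> L * a" using graded_step_le[OF r \<tau>] L by (intro mult_left_mono) auto
    then have "b \<le> a + L * a" using L(2) by linarith
    then show ?thesis by (simp add: algebra_simps)
  qed
  have wbd: "\<bar>w s\<bar> \<le> D * a powr (\<nu> - 2) * (b - a) * (b - s)" if s: "s \<in> {a..b}" for s
    unfolding w_def
  proof (rule linear_interpolation_error[OF ab(1) cont d1 d2 _ s])
    fix x assume x: "x \<in> {a<..<b}"
    have "x powr (\<nu> - 2) \<le> a powr (\<nu> - 2)" using x a0 \<nu> by (intro powr_mono2') auto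
    then show "\<bar>v'' x\<bar> \<le> D * a powr (\<nu> - 2)"
      using bd[OF x] D mult_left_mono order_trans by blast
  qed
  have dom: "(t - s) powr (-\<alpha> - 1) * \<bar>w s\<bar> \<le> 8 * A * ?E s" if s: "s \<in> {a<..<b}" for s
  proof -
    have s0: "0 < s" using s a0 by auto
    have e: "a powr (\<nu> - 2) \<le> (1 + L) ^ 3 * s powr (\<nu> - 2)"
    proof -
      have "s / (1 + L) \<le> a" using b_le s L by (simp add: field_simps)
      then have "a powr (\<nu> - 2) \<le> (s / (1 + L)) powr (\<nu> - 2)"
        using s0 L \<nu> by (intro powr_mono2') auto
      also have "\<dots> = (1 + L) powr (2 - \<nu>) * s powr (\<nu> - 2)"
        using s0 L powr_minus[of "1 + L" "\<nu> - 2"] by (simp add: powr_divide field_simps)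
      also have "\<dots> \<le> (1 + L) powr 3 * s powr (\<nu> - 2)"
        using L \<nu> by (intro mult_right_mono powr_mono) auto
      finally show ?thesis using L by simp
    qed
    have g: "?g a \<le> ?g s" "0 < ?g s" using graded_step_mono[OF r a0] graded_step_pos \<tau> s s0 by auto
    have ba: "b - a \<le> L * ?g s"
      using L g by (meson mult_left_mono order_trans zero_le_one)
    have "t - s \<le> L * (t - s)" using s ab L by (simp add: mult_le_cancel_right1)
    moreover have "b - s \<le> t - s" "b - s \<le> b - a" using s ab by auto
    ultimately have "b - s \<le> L * ?g s" "b - s \<le> L * (t - s)" using ba by linarith+
    then have bs: "b - s \<le> L * min (?g s) (t - s)" unfolding min_def by presburger
    have "\<bar>w s\<bar> \<le> D * a powr (\<nu> - 2) * (b - a) * (b - s)" using wbd s by auto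
    also have "\<dots> \<le> D * ((1 + L) ^ 3 * s powr (\<nu> - 2)) * (L * ?g s) * (L * min (?g s) (t - s))"
      using e ba bs D s ab L g by (intro mult_mono mult_nonneg_nonneg) auto
    also have "\<dots> = A * (?g s * min (?g s) (t - s) * s powr (\<nu> - 2))"
      by (simp add: A_def power2_eq_square)
    finally have "(t - s) powr (-\<alpha> - 1) * \<bar>w s\<bar>
        \<le> (t - s) powr (-\<alpha> - 1) * (A * (?g s * min (?g s) (t - s) * s powr (\<nu> - 2)))"
      by (rule mult_left_mono) simp
    also have "\<dots> = A * ((t - s) powr (-\<alpha> - 1) * (?g s * min (?g s) (t - s) * s powr (\<nu> - 2)))"
      by (simp add: mult_ac)
    also have "\<dots> \<le> A * (8 * ?E s)"
      using s ab \<tau> s0 \<alpha> r \<nu> A by (intro mult_left_mono kernel_graded_error_le) auto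
    finally show ?thesis by simp
  qed
  have kern: "(\<lambda>s. (t - s) powr (-\<alpha>)) integrable_on {a..b}"
    using kernel_has_integral[OF \<alpha>, of a b t] ab by (auto simp: integrable_on_def)
  have kernc: "(\<lambda>s. (t - s) powr (-\<alpha>) * ?c) integrable_on {a..b}"
    using integrable_on_mult_left[OF kern] .
  have eq: "(\<lambda>s. (t - s) powr (-\<alpha>) * (v' s - ?c))
      = (\<lambda>s. (t - s) powr (-\<alpha>) * v' s - (t - s) powr (-\<alpha>) * ?c)"
    by (simp add: right_diff_distrib)
  have Eint: "?E integrable_on {a..b}" using error_density_integrable \<alpha> \<tau> a0 ab by simp
  have "\<bar>integral {a..b} (\<lambda>s. (t - s) powr (-\<alpha>) * (v' s - ?c))\<bar>
      \<le> \<alpha> * integral {a..b} (\<lambda>s. 8 * A * ?E s)"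
  proof (rule abs_integral_kernel_derivative_le[OF \<alpha> ab, where w = w and D = "D * a powr (\<nu> - 2) * (b - a)"])
    show "continuous_on {a..b} w" unfolding w_def by (intro continuous_intros cont)
    show "w a = 0" "w b = 0" using ab by (simp_all add: w_def)
    show "(w has_real_derivative v' s - ?c) (at s)" if "s \<in> {a<..<b}" for s
      unfolding w_def using ab by (auto intro!: derivative_eq_intros d1[OF that])
    show "(\<lambda>s. (t - s) powr (-\<alpha>) * (v' s - ?c)) integrable_on {a..b}"
      unfolding eq by (rule integrable_diff[OF int kernc])
    show "(\<lambda>s. 8 * A * ?E s) integrable_on {a..b}" using Eint by (rule integrable_on_mult_right)
    show "0 \<le> 8 * A * ?E s" if "s \<in> {a..b}" for s
      using error_density_nonneg[of \<tau> t s] that \<tau> ab A by simp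
  qed (use wbd dom in auto)
  also have "\<dots> \<le> 1 * integral {a..b} (\<lambda>s. 8 * A * ?E s)"
    using \<alpha> A error_density_nonneg[of \<tau> t] \<tau> ab
    by (intro mult_right_mono integral_nonneg integrable_on_mult_right Eint) auto
  also have "\<dots> = 8 * A * integral {a..b} ?E" unfolding integral_mult_right by simp
  finally have "\<bar>integral {a..b} (\<lambda>s. (t - s) powr (-\<alpha>) * v' s)
      - integral {a..b} (\<lambda>s. (t - s) powr (-\<alpha>)) * ?c\<bar> \<le> 8 * A * integral {a..b} ?E"
    unfolding eq integral_diff[OF int kernc] integral_mult_left .
  then show ?thesis by (simp add: A_def abs_minus_commute mult.commute mult.left_commute)
qed


section \<open>The consistency error\<close>

lemma ratio_powr:
  fixes x y q :: real
  assumes "0 < x" "0 < y"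
  shows "x powr q * y powr (- q) = (x / y) powr q"
  using assms by (simp add: powr_divide powr_minus field_simps)

text \<open>Without integrability on the whole of \<open>{0..t}\<close> the Caputo integral could not be split at the mesh nodes.
Each of the two singularities is integrable, and near one of them the other factor is bounded.\<close>

lemma kernel_times_singular_integrable:
  fixes \<alpha> t C :: real and v :: "real \<Rightarrow> real"
  assumes \<alpha>: "0 < \<alpha>" "\<alpha> < 1" and t: "0 < t"
    and cont: "continuous_on {0<..<t} v"
    and bd: "\<And>s. s \<in> {0<..<t} \<Longrightarrow> \<bar>v s\<bar> \<le> C * s powr (\<alpha> - 1)"
  shows "(\<lambda>s. (t - s) powr (-\<alpha>) * v s) integrable_on {0..t}"
proof -
  let ?G = "\<lambda>s. C * (8 * t powr (-\<alpha>) * s powr (\<alpha> - 1)) + C * (8 * t powr (\<alpha> - 1) * (t - s) powr (-\<alpha>))"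
  have "0 \<le> C * (t / 2) powr (\<alpha> - 1)" using bd[of "t / 2"] t by force
  then have C: "0 \<le> C" using t by (simp add: zero_le_mult_iff)
  have "(\<lambda>s. (t - s) powr (-\<alpha>) * v s) integrable_on {0<..<t}"
  proof (rule measurable_bounded_by_integrable_imp_integrable)
    show "(\<lambda>s. (t - s) powr (-\<alpha>) * v s) \<in> borel_measurable (lebesgue_on {0<..<t})"
      by (rule continuous_imp_measurable_on_sets_lebesgue) (auto intro!: continuous_intros cont)
    have "(\<lambda>s. s powr (\<alpha> - 1)) integrable_on {0..t}"
      using \<alpha> t by (intro integrable_on_powr_from_0) auto
    moreover have "(\<lambda>s. (t - s) powr (-\<alpha>)) integrable_on {0..t}"
      using kernel_has_integral[OF \<alpha>, of 0 t t] t by (auto simp: integrable_on_def)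
    ultimately show "?G integrable_on {0<..<t}"
      unfolding integrable_on_Icc_iff_Ioo by (intro integrable_add integrable_on_mult_right)
    show "norm ((t - s) powr (-\<alpha>) * v s) \<le> ?G s" if s: "s \<in> {0<..<t}" for s
    proof -
      have "(t - s) powr (-\<alpha>) * s powr (\<alpha> - 1)
          \<le> 8 * t powr (-\<alpha>) * s powr (\<alpha> - 1) + 8 * t powr (\<alpha> - 1) * (t - s) powr (-\<alpha>)"
      proof (cases "s \<le> t / 2")
        case True
        have "(t - s) powr (-\<alpha>) * s powr (\<alpha> - 1) \<le> 8 * t powr (-\<alpha>) * s powr (\<alpha> - 1)"
          using True t \<alpha> by (intro mult_right_mono powr_half_le) auto
        then show ?thesis by (simp add: add_increasing2)
      next
        case False
        have "s powr (\<alpha> - 1) * (t - s) powr (-\<alpha>) \<le> 8 * t powr (\<alpha> - 1) * (t - s) powr (-\<alpha>)"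
          using False t \<alpha> by (intro mult_right_mono powr_half_le) auto
        then show ?thesis by (simp add: add_increasing mult.commute)
      qed
      then have G: "C * ((t - s) powr (-\<alpha>) * s powr (\<alpha> - 1)) \<le> ?G s"
        unfolding distrib_left[symmetric] using C by (rule mult_left_mono)
      have "norm ((t - s) powr (-\<alpha>) * v s) \<le> (t - s) powr (-\<alpha>) * (C * s powr (\<alpha> - 1))"
        using bd[OF s] by (simp add: abs_mult mult_left_mono)
      with G show ?thesis by (simp add: mult_ac)
    qed
  qed auto
  then show ?thesis unfolding integrable_on_Icc_iff_Ioo .
qed

lemma singular_increment_le:
  fixes u u1 :: "real \<Rightarrow> real" and \<alpha> C \<tau> :: real
  assumes \<alpha>: "0 < \<alpha>" and cont: "continuous_on {0..\<tau>} u"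
    and d1: "\<And>s. s \<in> {0<..<\<tau>} \<Longrightarrow> (u has_real_derivative u1 s) (at s)"
    and bd: "\<And>s. s \<in> {0<..<\<tau>} \<Longrightarrow> \<bar>u1 s\<bar> \<le> C * s powr (\<alpha> - 1)"
    and s: "0 < s" "s \<le> \<tau>"
  shows "\<bar>u s - u 0\<bar> \<le> C / \<alpha> * s powr \<alpha>"
proof -
  have "c * (u s - u 0) \<le> C / \<alpha> * s powr \<alpha>" if c: "\<bar>c\<bar> = 1" for c :: real
  proof -
    let ?f = "\<lambda>x. C / \<alpha> * x powr \<alpha> - c * u x"
    have d: "(?f has_real_derivative C * x powr (\<alpha> - 1) - c * u1 x) (at x)"
      if "0 < x" "x < s" for x
      using that s \<alpha> by (auto intro!: derivative_eq_intros d1)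
    have "continuous_on {0..s} u" using cont by (rule continuous_on_subset) (use s in auto)
    then have "continuous_on {0..s} ?f"
      using \<alpha> by (intro continuous_intros continuous_on_powr') auto
    then obtain l z where z: "0 < z" "z < s" "(?f has_real_derivative l) (at z)" "?f s - ?f 0 = (s - 0) * l"
      using MVT[OF s(1), of ?f] d by (metis (no_types, lifting) real_differentiable_def)
    have l: "l = C * z powr (\<alpha> - 1) - c * u1 z" using DERIV_unique[OF z(3) d] z by blast
    have "\<bar>c * u1 z\<bar> \<le> C * z powr (\<alpha> - 1)" using bd[of z] z s c by (simp add: abs_mult)
    then have "0 \<le> l" using l by linarith
    then have "0 \<le> ?f s - ?f 0" using z(4) s by simp
    then show ?thesis using \<alpha> by (simp add: algebra_simps)
  qed
  from this[of 1] this[of "-1"] show ?thesis by simp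
qed

text \<open>The second derivative is not bounded near the origin, so the interpolation error is estimated through
first derivatives: on the left half by the oscillation of \<open>u\<close>, of order \<open>\<tau> powr \<alpha>\<close>, and on the right half
by the mean value theorem. Both give \<open>\<tau> powr (\<alpha> - 1) * (\<tau> - s)\<close> up to a constant, which is the bound
that a function with second derivative \<open>\<tau> powr (\<alpha> - 2)\<close> would satisfy.\<close>

lemma first_interval_error:
  fixes u u1 :: "real \<Rightarrow> real" and \<alpha> r \<tau> t C :: real
  assumes \<alpha>: "0 < \<alpha>" "\<alpha> < 1" and r: "1 \<le> r" and \<tau>: "0 < \<tau>" "\<tau> \<le> t"
    and cont: "continuous_on {0..\<tau>} u"
    and d1: "\<And>s. s \<in> {0<..<\<tau>} \<Longrightarrow> (u has_real_derivative u1 s) (at s)"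
    and bd: "\<And>s. s \<in> {0<..<\<tau>} \<Longrightarrow> \<bar>u1 s\<bar> \<le> C * s powr (\<alpha> - 1)"
    and int: "(\<lambda>s. (t - s) powr (-\<alpha>) * u1 s) integrable_on {0..\<tau>}"
  shows "\<bar>(u \<tau> - u 0) / \<tau> * integral {0..\<tau>} (\<lambda>s. (t - s) powr (-\<alpha>))
            - integral {0..\<tau>} (\<lambda>s. (t - s) powr (-\<alpha>) * u1 s)\<bar>
         \<le> 72 * C * ((\<tau> / t) powr (\<alpha> + 1) + (1 / \<alpha> + 1 / (1 - \<alpha>)) * (\<tau> / t) powr ((2 - \<alpha>) / r))"
proof -
  let ?c = "(u \<tau> - u 0) / \<tau>"
  let ?E = "\<lambda>s. error_density \<alpha> r \<tau> \<alpha> t \<tau> s"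
  define A where "A = 9 * C / \<alpha>"
  define w where "w = (\<lambda>s. u s - (u 0 + ?c * s))"
  have t: "0 < t" using \<tau> by simp
  have "0 \<le> C * (\<tau> / 2) powr (\<alpha> - 1)" using bd[of "\<tau> / 2"] \<tau> by force
  then have C: "0 \<le> C" using \<tau> by (simp add: zero_le_mult_iff)
  then have A: "0 \<le> A" using \<alpha> by (simp add: A_def)
  have inc: "\<bar>u s - u 0\<bar> \<le> C / \<alpha> * s powr \<alpha>" if "0 < s" "s \<le> \<tau>" for s
    by (rule singular_increment_le[OF \<alpha>(1) cont d1 bd that])
  have p\<tau>: "\<tau> powr \<alpha> = \<tau> powr (\<alpha> - 1) * \<tau>"
    using powr_mult_base[of \<tau> "\<alpha> - 1"] \<tau> by (simp add: mult.commute)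
  have c: "\<bar>?c\<bar> \<le> C / \<alpha> * \<tau> powr (\<alpha> - 1)"
    using inc[OF \<tau>(1) order_refl] \<tau> unfolding p\<tau> by (simp add: abs_divide field_simps)
  have wcont: "continuous_on {0..\<tau>} w" unfolding w_def by (intro continuous_intros cont)
  have wd: "(w has_real_derivative u1 s - ?c) (at s)" if "s \<in> {0<..<\<tau>}" for s
    unfolding w_def using \<tau>(1) by (auto intro!: derivative_eq_intros d1[OF that])
  have w0: "w 0 = 0" "w \<tau> = 0" using \<tau> by (simp_all add: w_def)
  have wbd: "\<bar>w s\<bar> \<le> A * \<tau> powr (\<alpha> - 1) * (\<tau> - s)" if s: "s \<in> {0..\<tau>}" for s
  proof -
    consider "s = 0" | "0 < s" "s \<le> \<tau> / 2" | "\<tau> / 2 < s" "s < \<tau>" | "s = \<tau>" using s by fastforce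
    then show ?thesis
    proof cases
      case 1 then show ?thesis using w0 A \<tau> by simp
    next
      case 2
      have "\<bar>?c * s\<bar> \<le> (C / \<alpha> * \<tau> powr (\<alpha> - 1)) * \<tau>"
        unfolding abs_mult using c 2 \<tau> C \<alpha> by (intro mult_mono) auto
      moreover have "\<bar>u s - u 0\<bar> \<le> C / \<alpha> * \<tau> powr \<alpha>"
      proof -
        have "C / \<alpha> * s powr \<alpha> \<le> C / \<alpha> * \<tau> powr \<alpha>"
          using 2 \<alpha> C by (intro mult_left_mono powr_mono2) auto
        then show ?thesis using inc[of s] 2 \<tau> by linarith
      qed
      moreover have "\<bar>w s\<bar> \<le> \<bar>u s - u 0\<bar> + \<bar>?c * s\<bar>"
        using abs_triangle_ineq4[of "u s - u 0" "?c * s"] by (simp add: w_def diff_diff_eq)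
      ultimately have "\<bar>w s\<bar> \<le> C / \<alpha> * \<tau> powr \<alpha> + C / \<alpha> * \<tau> powr (\<alpha> - 1) * \<tau>"
        by linarith
      also have "\<dots> = C / \<alpha> * \<tau> powr (\<alpha> - 1) * (2 * \<tau>)"
        unfolding p\<tau> by (simp add: algebra_simps)
      also have "\<dots> \<le> C / \<alpha> * \<tau> powr (\<alpha> - 1) * (9 * (\<tau> - s))"
        using 2 C \<alpha> by (intro mult_left_mono) auto
      also have "\<dots> = A * \<tau> powr (\<alpha> - 1) * (\<tau> - s)"
        using \<alpha> unfolding A_def by (simp add: field_simps)
      finally show ?thesis .
    next
      case 3
      have "continuous_on {s..\<tau>} w" using wcont by (rule continuous_on_subset) (use 3 \<tau> in auto)
      moreover have "w differentiable (at x)" if "s < x" "x < \<tau>" for x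
        using wd[of x] that 3 \<tau> by (auto simp: real_differentiable_def)
      ultimately obtain l z where z: "s < z" "z < \<tau>" "(w has_real_derivative l) (at z)"
          "w \<tau> - w s = (\<tau> - s) * l"
        using MVT[OF 3(2)] by blast
      have zin: "z \<in> {0<..<\<tau>}" using z 3 \<tau> by auto
      have l: "l = u1 z - ?c" by (rule DERIV_unique[OF z(3) wd[OF zin]])
      have "C * z powr (\<alpha> - 1) \<le> C * (8 * \<tau> powr (\<alpha> - 1))"
        using z 3 \<tau> \<alpha> C by (intro mult_left_mono powr_half_le) auto
      moreover have "C * (8 * \<tau> powr (\<alpha> - 1)) \<le> C / \<alpha> * (8 * \<tau> powr (\<alpha> - 1))"
        using \<alpha> C by (intro mult_right_mono) (auto simp: field_simps mult_left_le)
      moreover have "\<bar>l\<bar> \<le> \<bar>u1 z\<bar> + \<bar>?c\<bar>" unfolding l by (rule abs_triangle_ineq4)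
      ultimately have "\<bar>l\<bar> \<le> C / \<alpha> * (8 * \<tau> powr (\<alpha> - 1)) + C / \<alpha> * \<tau> powr (\<alpha> - 1)"
        using c bd[OF zin] by linarith
      also have "\<dots> = A * \<tau> powr (\<alpha> - 1)" using \<alpha> unfolding A_def by (simp add: field_simps)
      finally have "\<bar>l\<bar> \<le> A * \<tau> powr (\<alpha> - 1)" .
      then have "\<bar>l\<bar> * (\<tau> - s) \<le> A * \<tau> powr (\<alpha> - 1) * (\<tau> - s)"
        using 3 by (intro mult_right_mono) auto
      moreover have "\<bar>w s\<bar> = \<bar>l\<bar> * (\<tau> - s)"
      proof -
        have "w s = - ((\<tau> - s) * l)" using z(4) w0 by simp
        then show ?thesis using 3 by (simp add: abs_mult)
      qed
      ultimately show ?thesis by simp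
    next
      case 4 then show ?thesis using w0 by simp
    qed
  qed
  have g\<tau>: "graded_step r \<tau> \<tau> = \<tau>" using \<tau> by (simp add: graded_step_def flip: powr_add)
  have dom: "(t - s) powr (-\<alpha> - 1) * \<bar>w s\<bar> \<le> 8 * A * ?E s" if s: "s \<in> {0<..<\<tau>}" for s
  proof -
    have "A * \<tau> powr (\<alpha> - 1) * (\<tau> - s) \<le> A * \<tau> powr (\<alpha> - 1) * min \<tau> (t - s)"
      using s \<tau> A by (intro mult_left_mono) auto
    also have "\<dots> = A * (\<tau> * min \<tau> (t - s) * \<tau> powr (\<alpha> - 2))"
    proof -
      have "\<tau> powr (\<alpha> - 1) = \<tau> * \<tau> powr (\<alpha> - 2)"
        using powr_mult_base[of \<tau> "\<alpha> - 2"] \<tau> by simp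
      then show ?thesis by simp
    qed
    finally have "A * \<tau> powr (\<alpha> - 1) * (\<tau> - s) \<le> A * (\<tau> * min \<tau> (t - s) * \<tau> powr (\<alpha> - 2))" .
    then have "\<bar>w s\<bar> \<le> A * (\<tau> * min \<tau> (t - s) * \<tau> powr (\<alpha> - 2))"
      using wbd[of s] s by simp
    then have "(t - s) powr (-\<alpha> - 1) * \<bar>w s\<bar>
        \<le> (t - s) powr (-\<alpha> - 1) * (A * (\<tau> * min \<tau> (t - s) * \<tau> powr (\<alpha> - 2)))"
      by (rule mult_left_mono) simp
    also have "\<dots> = A * ((t - s) powr (-\<alpha> - 1) * (\<tau> * min \<tau> (t - s) * \<tau> powr (\<alpha> - 2)))"
      by (simp add: mult_ac)
    also have "\<dots> \<le> A * (8 * ?E s)"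
      using kernel_graded_error_le[OF \<alpha> r \<tau>(1) order_refl, of s t \<alpha>] s \<tau> \<alpha> A
      unfolding g\<tau> by (intro mult_left_mono) auto
    finally show ?thesis by simp
  qed
  note near = near_part_integral[OF \<alpha> \<open>0 < \<tau>\<close> t less_imp_le[OF t], of \<alpha> r]
  let ?n = "\<lambda>s. t powr (\<alpha> - 2) * graded_step r \<tau> t *
              ((t - s) powr (-\<alpha> - 1) * min (graded_step r \<tau> t) (t - s))"
  let ?k = "t powr (-\<alpha> - 1) * (\<tau> powr (2 / r) * \<tau> powr (\<alpha> - 2 / r))"
  have n: "?n integrable_on {0..t}" using near(1) .
  then have n\<tau>: "?n integrable_on {0..\<tau>}" by (rule integrable_on_subinterval) (use \<tau> in auto)
  have Edef: "?E = (\<lambda>s. ?k + ?n s)" by (simp add: error_density_def)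
  have Eint: "?E integrable_on {0..\<tau>}" unfolding Edef using n\<tau> by (intro integrable_add) auto
  have "integral {0..\<tau>} ?E = \<tau> * ?k + integral {0..\<tau>} ?n"
    unfolding Edef using n\<tau> \<tau> by (subst integral_add) auto
  moreover have "\<tau> * ?k = (\<tau> / t) powr (\<alpha> + 1)"
  proof -
    have "?k = t powr (-\<alpha> - 1) * \<tau> powr \<alpha>" by (simp flip: powr_add)
    moreover have "\<tau> * \<tau> powr \<alpha> = \<tau> powr (\<alpha> + 1)"
      using powr_mult_base[of \<tau> \<alpha>] \<tau> by (simp add: add.commute)
    moreover have "t powr (-\<alpha> - 1) = inverse (t powr (\<alpha> + 1))"
      using powr_minus[of t "\<alpha> + 1"] by simp
    ultimately show ?thesis using \<tau> t by (simp add: powr_divide field_simps)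
  qed
  moreover have "integral {0..\<tau>} ?n \<le> integral {0..t} ?n"
    using \<tau> n n\<tau> graded_step_pos[OF \<tau>(1) t, of r] by (intro integral_subset_le) auto
  moreover have "integral {0..t} ?n \<le> (1 / \<alpha> + 1 / (1 - \<alpha>)) * (\<tau> / t) powr ((2 - \<alpha>) / r)"
  proof -
    have "\<alpha> - \<alpha> - (2 - \<alpha>) / r = - ((2 - \<alpha>) / r)" by simp
    then show ?thesis using near(2) unfolding ratio_powr[OF \<tau>(1) t, symmetric] by metis
  qed
  ultimately have Eval: "integral {0..\<tau>} ?E
      \<le> (\<tau> / t) powr (\<alpha> + 1) + (1 / \<alpha> + 1 / (1 - \<alpha>)) * (\<tau> / t) powr ((2 - \<alpha>) / r)" by linarith
  have kern: "(\<lambda>s. (t - s) powr (-\<alpha>)) integrable_on {0..\<tau>}"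
    using kernel_has_integral[OF \<alpha>, of 0 \<tau> t] \<tau> by (auto simp: integrable_on_def)
  have kernc: "(\<lambda>s. (t - s) powr (-\<alpha>) * ?c) integrable_on {0..\<tau>}"
    using integrable_on_mult_left[OF kern] .
  have eq: "(\<lambda>s. (t - s) powr (-\<alpha>) * (u1 s - ?c))
      = (\<lambda>s. (t - s) powr (-\<alpha>) * u1 s - (t - s) powr (-\<alpha>) * ?c)"
    by (simp add: right_diff_distrib)
  have "\<bar>integral {0..\<tau>} (\<lambda>s. (t - s) powr (-\<alpha>) * (u1 s - ?c))\<bar>
      \<le> \<alpha> * integral {0..\<tau>} (\<lambda>s. 8 * A * ?E s)"
  proof (rule abs_integral_kernel_derivative_le[OF \<alpha> \<tau> wcont w0 wd, where D = "A * \<tau> powr (\<alpha> - 1)"])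
    show "(\<lambda>s. (t - s) powr (-\<alpha>) * (u1 s - ?c)) integrable_on {0..\<tau>}"
      unfolding eq by (rule integrable_diff[OF int kernc])
    show "(\<lambda>s. 8 * A * ?E s) integrable_on {0..\<tau>}" using Eint by (rule integrable_on_mult_right)
    show "0 \<le> 8 * A * ?E s" if "s \<in> {0..\<tau>}" for s
      using error_density_nonneg[of \<tau> t s] that \<tau> A t by simp
  qed (use wbd dom in auto)
  also have "\<dots> = 72 * C * integral {0..\<tau>} ?E"
    unfolding integral_mult_right A_def using \<alpha> by simp
  also have "\<dots> \<le> 72 * C * ((\<tau> / t) powr (\<alpha> + 1) + (1 / \<alpha> + 1 / (1 - \<alpha>)) * (\<tau> / t) powr ((2 - \<alpha>) / r))"
    using C Eval by (intro mult_left_mono) auto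
  finally have "\<bar>integral {0..\<tau>} (\<lambda>s. (t - s) powr (-\<alpha>) * u1 s)
      - integral {0..\<tau>} (\<lambda>s. (t - s) powr (-\<alpha>)) * ?c\<bar>
      \<le> 72 * C * ((\<tau> / t) powr (\<alpha> + 1) + (1 / \<alpha> + 1 / (1 - \<alpha>)) * (\<tau> / t) powr ((2 - \<alpha>) / r))"
    unfolding eq integral_diff[OF int kernc] integral_mult_left .
  then show ?thesis by (simp add: abs_minus_commute mult.commute)
qed

lemma sum_mesh_integrals:
  fixes F :: "real \<Rightarrow> real"
  assumes mesh: "is_mesh T N t" and "m \<le> N" "k \<le> m" and F: "F integrable_on {t k..t m}"
  shows "(\<Sum>j=Suc k..m. integral {t (j - 1)..t j} F) = integral {t k..t m} F"
  using \<open>k \<le> m\<close> \<open>m \<le> N\<close> F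
proof (induction m rule: dec_induct)
  case (step n)
  have le: "t k \<le> t n" "t n \<le> t (Suc n)" using mesh_le[OF mesh] step by auto
  have "F integrable_on {t k..t n}"
    using step.prems(2) by (rule integrable_on_subinterval) (use le in auto)
  then have "(\<Sum>j=Suc k..n. integral {t (j - 1)..t j} F) = integral {t k..t n} F"
    using step by simp
  then show ?case using step Henstock_Kurzweil_Integration.integral_combine[OF le step.prems(2)] by simp
qed simp

text \<open>The summand of \<open>error_density\<close> that lives near \<open>t m\<close> limits \<open>p\<close> to \<open>(2 - \<alpha>) / r\<close>. The first interval
and the summand that lives far from \<open>t m\<close> contribute the decay of the kernel, and \<open>p < \<alpha> + 1\<close> keeps
the latter free of logarithms.\<close>

lemma consistency_error:
  fixes u u1 u2 :: "real \<Rightarrow> real" and \<alpha> r T L C p :: real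
  assumes \<alpha>: "0 < \<alpha>" "\<alpha> < 1" and r: "1 \<le> r" and L: "1 \<le> L"
    and p: "p \<le> (2 - \<alpha>) / r" "p < \<alpha> + 1"
    and cont: "continuous_on {0..T} u" and cont1: "continuous_on {0<..<T} u1"
    and d1: "\<And>s. s \<in> {0<..<T} \<Longrightarrow> (u has_real_derivative u1 s) (at s)"
    and d2: "\<And>s. s \<in> {0<..<T} \<Longrightarrow> (u1 has_real_derivative u2 s) (at s)"
    and b1: "\<And>s. s \<in> {0<..<T} \<Longrightarrow> \<bar>u1 s\<bar> \<le> C * s powr (\<alpha> - 1)"
    and b2: "\<And>s. s \<in> {0<..<T} \<Longrightarrow> \<bar>u2 s\<bar> \<le> C * s powr (\<alpha> - 2)"
    and mesh: "is_mesh T N t" and m: "1 \<le> m" "m \<le> N"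
    and width: "\<And>j. 2 \<le> j \<Longrightarrow> j \<le> N \<Longrightarrow> t j - t (j - 1) \<le> L * graded_step r (t 1) (t (j - 1))"
  shows "\<bar>l1_sum \<alpha> t (\<lambda>j. u (t j)) m - integral {0..t m} (\<lambda>s. (t m - s) powr (-\<alpha>) * u1 s)\<bar>
     \<le> (72 * C * (1 + (1 / \<alpha> + 1 / (1 - \<alpha>)))
         + 8 * C * L\<^sup>2 * (1 + L) ^ 3 * (1 / (\<alpha> + 1 - p) + (1 / \<alpha> + 1 / (1 - \<alpha>)))) * (t 1 / t m) powr p"
proof -
  define \<tau> c where "\<tau> = t 1" and "c = 1 / \<alpha> + 1 / (1 - \<alpha>)"
  let ?x = "\<tau> / t m" and ?B = "8 * C * L\<^sup>2 * (1 + L) ^ 3"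
  let ?K = "\<lambda>s. (t m - s) powr (-\<alpha>) * u1 s"
  let ?E = "\<lambda>s. error_density \<alpha> r \<tau> \<alpha> (t m) s s"
  let ?e = "\<lambda>j. (u (t j) - u (t (j - 1))) * l1_weight \<alpha> t m j - integral {t (j - 1)..t j} ?K"
  have t0: "t 0 = 0" "t N = T" using mesh by (auto simp: is_mesh_def)
  have \<tau>: "0 < \<tau>" "\<tau> \<le> t m" using mesh_pos[OF mesh, of 1] mesh_le[OF mesh, of 1 m] m by (auto simp: \<tau>_def)
  have tm: "0 < t m" "t m \<le> T" using mesh_pos[OF mesh m] mesh_le[OF mesh, of m N] m t0 by auto
  have T: "0 < T" using tm by simp
  have "0 \<le> C * (T / 2) powr (\<alpha> - 1)" using b1[of "T / 2"] T by force
  then have C: "0 \<le> C" using T by (simp add: zero_le_mult_iff)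
  have c: "0 \<le> c" using \<alpha> by (simp add: c_def)
  have x: "0 < ?x" "?x \<le> 1" using \<tau> tm by auto
  have powx: "?x powr q \<le> ?x powr p" if "p \<le> q" for q
    using x that by (intro powr_mono') auto
  have Kint: "?K integrable_on {0..t m}"
    by (rule kernel_times_singular_integrable[OF \<alpha> tm(1), where C = C])
      (use cont1 b1 tm in \<open>auto intro: continuous_on_subset\<close>)
  have split: "{1..m} = insert 1 {2..m}" using m by auto
  have "(\<Sum>j=1..m. integral {t (j - 1)..t j} ?K) = integral {0..t m} ?K"
    using sum_mesh_integrals[OF mesh m(2), of 0 ?K] Kint t0 by simp
  then have "l1_sum \<alpha> t (\<lambda>j. u (t j)) m - integral {0..t m} ?K = (\<Sum>j=1..m. ?e j)"
    by (simp add: l1_sum_def sum_subtractf)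
  also have "\<dots> = ?e 1 + (\<Sum>j=2..m. ?e j)" unfolding split by simp
  finally have main: "\<bar>l1_sum \<alpha> t (\<lambda>j. u (t j)) m - integral {0..t m} ?K\<bar>
      \<le> \<bar>?e 1\<bar> + (\<Sum>j=2..m. \<bar>?e j\<bar>)"
    using sum_abs[of ?e "{2..m}"] by linarith
  have e1: "\<bar>?e 1\<bar> \<le> 72 * C * (1 + c) * ?x powr p"
  proof -
    have "\<bar>?e 1\<bar> \<le> 72 * C * (?x powr (\<alpha> + 1) + c * ?x powr ((2 - \<alpha>) / r))"
    proof -
      have "?K integrable_on {0..\<tau>}" using Kint by (rule integrable_on_subinterval) (use \<tau> in auto)
      moreover have "continuous_on {0..\<tau>} u" using cont by (rule continuous_on_subset) (use \<tau> tm in auto)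
      ultimately show ?thesis
        using first_interval_error[OF \<alpha> r \<tau>, of u u1 C] d1 b1 \<tau> tm t0
        by (simp add: \<tau>_def l1_weight_def c_def mult_ac)
    qed
    also have "\<dots> \<le> 72 * C * (?x powr p + c * ?x powr p)"
      using C c p by (intro mult_left_mono add_mono powx) auto
    finally show ?thesis by (simp add: algebra_simps)
  qed
  have ej: "\<bar>?e j\<bar> \<le> ?B * integral {t (j - 1)..t j} ?E" if j: "j \<in> {2..m}" for j
  proof -
    have a: "\<tau> \<le> t (j - 1)" "t (j - 1) < t j" "t j \<le> t m"
      using mesh_le[OF mesh, of 1 "j - 1"] mesh_less[OF mesh, of "j - 1" j] mesh_le[OF mesh, of j m] m j
      by (auto simp: \<tau>_def)
    have w: "t j - t (j - 1) \<le> L * graded_step r \<tau> (t (j - 1))" using width[of j] j m by (simp add: \<tau>_def)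
    have "?K integrable_on {t (j - 1)..t j}"
      using Kint by (rule integrable_on_subinterval) (use \<tau> a in auto)
    moreover have "continuous_on {t (j - 1)..t j} u"
      using cont by (rule continuous_on_subset) (use \<tau> a tm in auto)
    ultimately show ?thesis
      using smooth_interval_error[OF \<alpha> r \<tau>(1) a L w, of \<alpha> u u1 u2 C] d1 d2 b2 \<tau> tm a \<alpha>
      by (simp add: l1_weight_def)
  qed
  have Eint: "?E integrable_on {t 1..t m}"
    using error_density_integrable[OF \<alpha>, of \<tau> \<tau> "t m" "t m"] \<tau> by (simp add: \<tau>_def)
  have "(\<Sum>j=2..m. \<bar>?e j\<bar>) \<le> (\<Sum>j=2..m. ?B * integral {t (j - 1)..t j} ?E)"
    by (intro sum_mono ej)
  also have "\<dots> = ?B * integral {\<tau>..t m} ?E"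
    unfolding sum_distrib_left[symmetric]
    using sum_mesh_integrals[OF mesh m(2,1) Eint] by (simp add: \<tau>_def numeral_2_eq_2)
  also have "integral {\<tau>..t m} ?E \<le> (1 / (\<alpha> + 1 - p) + c) * ?x powr p"
  proof -
    have far: "integral {\<tau>..t m} (\<lambda>s. \<tau> powr (2 / r) * s powr (\<alpha> - 2 / r))
        \<le> \<tau> powr p * (t m powr (\<alpha> - p + 1) / (\<alpha> - p + 1))"
    proof -
      have "integral {\<tau>..t m} (\<lambda>s. \<tau> powr (2 / r) * s powr (\<alpha> - 2 / r))
          \<le> integral {\<tau>..t m} (\<lambda>s. \<tau> powr p * s powr (\<alpha> - p))"
      proof (rule integral_le)
        show "\<tau> powr (2 / r) * s powr (\<alpha> - 2 / r) \<le> \<tau> powr p * s powr (\<alpha> - p)"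
          if s: "s \<in> {\<tau>..t m}" for s
        proof -
          have s0: "0 < s" using s \<tau> by auto
          have "p \<le> 2 / r" using p(1) \<alpha> r by (smt (verit) divide_right_mono)
          then have "(\<tau> / s) powr (2 / r) \<le> (\<tau> / s) powr p"
            using s s0 \<tau> by (intro powr_mono') auto
          then have "s powr \<alpha> * (\<tau> / s) powr (2 / r) \<le> s powr \<alpha> * (\<tau> / s) powr p"
            by (intro mult_left_mono) auto
          then show ?thesis using s0 \<tau> by (simp add: powr_divide powr_diff field_simps)
        qed
      qed (use \<tau> in \<open>auto intro!: integrable_continuous_real continuous_intros\<close>)
      also have "\<dots> = \<tau> powr p * ((t m powr (\<alpha> - p + 1) - \<tau> powr (\<alpha> - p + 1)) / (\<alpha> - p + 1))"
        unfolding integral_mult_right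
        using powr_has_integral_pos[OF \<tau>, of "\<alpha> - p"] p by (simp add: integral_unique)
      also have "\<dots> \<le> \<tau> powr p * (t m powr (\<alpha> - p + 1) / (\<alpha> - p + 1))"
        using p by (intro mult_left_mono divide_right_mono) auto
      finally show ?thesis .
    qed
    have "integral {\<tau>..t m} ?E \<le> t m powr (-\<alpha> - 1) * (\<tau> powr p * (t m powr (\<alpha> - p + 1) / (\<alpha> - p + 1)))
        + c * (\<tau> powr ((2 - \<alpha>) / r) * t m powr (\<alpha> - \<alpha> - (2 - \<alpha>) / r))"
      using error_density_integral_le[OF \<alpha> \<tau>(1) \<tau>, of r \<alpha>] mult_left_mono[OF far powr_ge_zero[of "t m" "-\<alpha> - 1"]]
      unfolding c_def by linarith
    also have "t m powr (-\<alpha> - 1) * (\<tau> powr p * (t m powr (\<alpha> - p + 1) / (\<alpha> - p + 1)))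
        = 1 / (\<alpha> + 1 - p) * (\<tau> powr p * (t m powr (-\<alpha> - 1) * t m powr (\<alpha> - p + 1)))"
      by (simp add: algebra_simps)
    also have "t m powr (-\<alpha> - 1) * t m powr (\<alpha> - p + 1) = t m powr (- p)"
      by (simp flip: powr_add)
    also have "\<tau> powr p * t m powr (- p) = ?x powr p"
      using ratio_powr[OF \<tau>(1) tm(1)] by simp
    also have "\<tau> powr ((2 - \<alpha>) / r) * t m powr (\<alpha> - \<alpha> - (2 - \<alpha>) / r) = ?x powr ((2 - \<alpha>) / r)"
      using ratio_powr[OF \<tau>(1) tm(1)] by simp
    also have "1 / (\<alpha> + 1 - p) * ?x powr p + c * ?x powr ((2 - \<alpha>) / r)
        \<le> 1 / (\<alpha> + 1 - p) * ?x powr p + c * ?x powr p"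
      using c powx[OF p(1)] by (intro add_left_mono mult_left_mono) auto
    finally show ?thesis by (simp add: algebra_simps)
  qed
  finally have "(\<Sum>j=2..m. \<bar>?e j\<bar>) \<le> ?B * ((1 / (\<alpha> + 1 - p) + c) * ?x powr p)"
    using C L by (simp add: mult_left_mono)
  with main e1 have "\<bar>l1_sum \<alpha> t (\<lambda>j. u (t j)) m - integral {0..t m} ?K\<bar>
      \<le> 72 * C * (1 + c) * ?x powr p + ?B * ((1 / (\<alpha> + 1 - p) + c) * ?x powr p)" by linarith
  also have "\<dots> = (72 * C * (1 + c) + ?B * (1 / (\<alpha> + 1 - p) + c)) * ?x powr p"
    by (simp add: algebra_simps)
  finally show ?thesis unfolding c_def \<tau>_def .
qed


section \<open>Barrier functions\<close>

text \<open>The derivative of \<open>s powr (\<alpha> - 1)\<close> against the kernel has an elementary antiderivative because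
\<open>s powr (\<alpha> - 1)\<close> spans the kernel of the Riemann-Liouville derivative of order \<open>\<alpha>\<close>.\<close>

lemma kernel_power_derivative_has_integral:
  fixes \<alpha> \<sigma> t :: real
  assumes \<alpha>: "0 < \<alpha>" "\<alpha> < 1" and "0 < \<sigma>" "\<sigma> \<le> t"
  shows "((\<lambda>s. (t - s) powr (-\<alpha>) * ((\<alpha> - 1) * s powr (\<alpha> - 2))) has_integral
           - ((t - \<sigma>) powr (1 - \<alpha>) * \<sigma> powr (\<alpha> - 1) / t)) {\<sigma>..t}"
proof -
  let ?F = "\<lambda>s. (t - s) powr (1 - \<alpha>) * s powr (\<alpha> - 1) / t"
  let ?f = "\<lambda>s. (t - s) powr (-\<alpha>) * ((\<alpha> - 1) * s powr (\<alpha> - 2))"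
  have "(?f has_integral ?F t - ?F \<sigma>) {\<sigma>..t}"
  proof (rule fundamental_theorem_of_calculus_interior)
    show "continuous_on {\<sigma>..t} ?F"
      using assms by (intro continuous_intros continuous_on_powr') auto
    show "(?F has_vector_derivative ?f x) (at x)" if x: "x \<in> {\<sigma><..<t}" for x
    proof -
      have "(?F has_real_derivative
          (- (1 - \<alpha>) * (t - x) powr (-\<alpha>) * x powr (\<alpha> - 1)
            + (t - x) powr (1 - \<alpha>) * ((\<alpha> - 1) * x powr (\<alpha> - 2))) / t) (at x)"
        using x assms by (intro DERIV_cdivide) (auto intro!: derivative_eq_intros simp: algebra_simps)
      moreover have "(t - x) powr (1 - \<alpha>) = (t - x) powr (-\<alpha>) * (t - x)"
        using powr_mult_base[of "t - x" "-\<alpha>"] x by (simp add: mult.commute)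
      moreover have "x powr (\<alpha> - 1) = x powr (\<alpha> - 2) * x"
        using powr_mult_base[of x "\<alpha> - 2"] x assms by (simp add: mult.commute)
      moreover have "(- (1 - \<alpha>) * A * (B * x) + (A * (t - x)) * ((\<alpha> - 1) * B)) / t = A * ((\<alpha> - 1) * B)"
        for A B :: real using x assms by (simp add: field_simps)
      ultimately show ?thesis
        by (simp flip: has_real_derivative_iff_has_vector_derivative)
    qed
  qed (use assms in auto)
  then show ?thesis by simp
qed

text \<open>The kernel function \<open>s powr (\<alpha> - 1)\<close> of the Riemann-Liouville derivative, made constant up to \<open>\<sigma>\<close>. The
jump down to the initial value \<open>0\<close>, needed for the comparison principle, is spread over the first mesh
interval by the piecewise linear interpolation in the L1 operator.\<close>

definition plateau_barrier :: "real \<Rightarrow> (nat \<Rightarrow> real) \<Rightarrow> real \<Rightarrow> nat \<Rightarrow> real" where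
  "plateau_barrier \<alpha> t \<sigma> j = (if j = 0 then 0 else max (t j) \<sigma> powr (\<alpha> - 1))"

lemma plateau_barrier_before:
  assumes "0 < \<alpha>" "\<alpha> < 1" and mesh: "is_mesh T N t" and m: "1 \<le> m" "m \<le> N" "t m \<le> \<sigma>"
  shows "t m powr (-\<alpha>) * \<sigma> powr (\<alpha> - 1) \<le> l1_sum \<alpha> t (plateau_barrier \<alpha> t \<sigma>) m"
proof -
  have le: "t j \<le> \<sigma>" if "j \<le> m" for j using mesh_le[OF mesh that m(2)] m(3) by simp
  have "t m powr (-\<alpha>) * (plateau_barrier \<alpha> t \<sigma> m - plateau_barrier \<alpha> t \<sigma> 0)
      \<le> l1_sum \<alpha> t (plateau_barrier \<alpha> t \<sigma>) m"
    by (rule l1_sum_monotone_lower[OF assms(1-3) m(2)])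
      (use le in \<open>auto simp: plateau_barrier_def max_absorb2\<close>)
  then show ?thesis using m le[of m] by (simp add: plateau_barrier_def max_absorb2)
qed

text \<open>For the continuous function, the jump at \<open>0\<close> contributes \<open>x powr (-\<alpha>) * \<sigma> powr (\<alpha> - 1)\<close> with \<open>x = t m\<close>
and \<open>\<sigma> = t k\<close>. The decreasing part beyond \<open>\<sigma>\<close> nearly cancels it and leaves
\<open>\<sigma> powr (\<alpha> - 1) * (x powr (1 - \<alpha>) - (x - \<sigma>) powr (1 - \<alpha>)) / x\<close>, which is at least
\<open>(1 - \<alpha>) * \<sigma> powr \<alpha> * x powr (-\<alpha> - 1)\<close>. Piecewise linear interpolation perturbs this only on
\<open>{\<sigma>..x}\<close>, where the mesh width is small relative to \<open>s\<close>; the condition \<open>\<alpha> \<le> (2 - \<alpha>) / r\<close> makes the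
perturbation decay in \<open>x\<close> at least as fast as the main term. The kink at \<open>\<sigma>\<close> does no harm because it sits at
a mesh node.\<close>

lemma plateau_barrier_after:
  assumes \<alpha>: "0 < \<alpha>" "\<alpha> < 1" and r: "1 \<le> r" and L: "1 \<le> L" and p0: "\<alpha> \<le> (2 - \<alpha>) / r"
    and mesh: "is_mesh T N t" and k: "1 \<le> k" "k < m" "m \<le> N"
    and width: "\<And>j. 2 \<le> j \<Longrightarrow> j \<le> N \<Longrightarrow> t j - t (j - 1) \<le> L * graded_step r (t 1) (t (j - 1))"
  shows "t k powr \<alpha> * t m powr (-\<alpha> - 1) *
           ((1 - \<alpha>) - 16 * L\<^sup>2 * (1 + L) ^ 3 * (1 / (2 / r - \<alpha>) + (1 / \<alpha> + 1 / (1 - \<alpha>))) * (t 1 / t k) powr \<alpha>)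
         \<le> l1_sum \<alpha> t (plateau_barrier \<alpha> t (t k)) m"
proof -
  define \<tau> \<sigma> c x where "\<tau> = t 1" and "\<sigma> = t k" and "c = 1 / \<alpha> + 1 / (1 - \<alpha>)" and "x = t m"
  let ?B = "plateau_barrier \<alpha> t \<sigma>" and ?w = "l1_weight \<alpha> t m"
  let ?C = "16 * L\<^sup>2 * (1 + L) ^ 3"
  let ?K = "\<lambda>s. (x - s) powr (-\<alpha>) * ((\<alpha> - 1) * s powr (\<alpha> - 2))"
  let ?E = "\<lambda>s. error_density \<alpha> r \<tau> (\<alpha> - 1) x s s"
  have \<tau>: "0 < \<tau>" "\<tau> \<le> \<sigma>" "\<sigma> < x"
    using mesh_pos[OF mesh, of 1] mesh_le[OF mesh, of 1 k] mesh_less[OF mesh, of k m] k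
    by (auto simp: \<tau>_def \<sigma>_def x_def)
  have pos: "0 < \<sigma>" "0 < x" using \<tau> by auto
  have c: "0 \<le> c" using \<alpha> by (simp add: c_def)
  have far_exp: "\<alpha> < 2 / r"
  proof -
    have "(2 - \<alpha>) / r < 2 / r" using \<alpha> r by (intro divide_strict_right_mono) auto
    then show ?thesis using p0 by linarith
  qed
  \<comment> \<open>Up to the node \<open>t k\<close> the barrier is constant apart from its jump on the first interval.\<close>
  have before: "x powr (-\<alpha>) * \<sigma> powr (\<alpha> - 1) \<le> (\<Sum>j=1..k. (?B j - ?B (j - 1)) * ?w j)"
  proof -
    have "(?B j - ?B (j - 1)) * ?w j = (if j = 1 then \<sigma> powr (\<alpha> - 1) * ?w 1 else 0)" if "j \<in> {1..k}" for j
      using mesh_le[OF mesh, of j k] mesh_le[OF mesh, of "j - 1" k] k that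
      by (auto simp: plateau_barrier_def \<sigma>_def max_absorb2)
    then have "(\<Sum>j=1..k. (?B j - ?B (j - 1)) * ?w j) = (\<Sum>j=1..k. if j = 1 then \<sigma> powr (\<alpha> - 1) * ?w 1 else 0)"
      by (rule sum.cong[OF refl])
    also have "\<dots> = \<sigma> powr (\<alpha> - 1) * ?w 1" using k by simp
    finally show ?thesis
      using mult_left_mono[OF l1_weight_lower[OF \<alpha> mesh, of 1 m], of "\<sigma> powr (\<alpha> - 1)"] k
      by (simp add: x_def mult.commute)
  qed
  have Kint: "?K integrable_on {\<sigma>..x}"
    using kernel_power_derivative_has_integral[OF \<alpha> pos(1), of x] \<tau> by (auto simp: integrable_on_def)
  have Eint: "?E integrable_on {\<sigma>..x}"
    using error_density_integrable[OF \<alpha> \<tau>(1) pos(1), of x x] \<tau> by simp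
  have after_j: "integral {t (j - 1)..t j} ?K - ?C * integral {t (j - 1)..t j} ?E
      \<le> (?B j - ?B (j - 1)) * ?w j" if j: "j \<in> {Suc k..m}" for j
  proof -
    have a: "\<sigma> \<le> t (j - 1)" "t (j - 1) < t j" "t j \<le> x"
      using mesh_le[OF mesh, of k "j - 1"] mesh_less[OF mesh, of "j - 1" j] mesh_le[OF mesh, of j m] k j
      by (auto simp: \<sigma>_def x_def)
    have wj: "t j - t (j - 1) \<le> L * graded_step r \<tau> (t (j - 1))" using width[of j] j k by (simp add: \<tau>_def)
    have "\<bar>(t j powr (\<alpha> - 1) - t (j - 1) powr (\<alpha> - 1)) / (t j - t (j - 1))
             * integral {t (j - 1)..t j} (\<lambda>s. (x - s) powr (-\<alpha>))
            - integral {t (j - 1)..t j} ?K\<bar>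
         \<le> 8 * 2 * L\<^sup>2 * (1 + L) ^ 3 * integral {t (j - 1)..t j} ?E"
    proof (rule smooth_interval_error[OF \<alpha> r \<tau>(1) _ a(2,3) L wj,
          where v'' = "\<lambda>s. (\<alpha> - 1) * ((\<alpha> - 2) * s powr (\<alpha> - 3))"])
      show "continuous_on {t (j - 1)..t j} (\<lambda>s. s powr (\<alpha> - 1))"
        using a pos by (intro continuous_intros) auto
      show "((\<lambda>s. s powr (\<alpha> - 1)) has_real_derivative (\<alpha> - 1) * s powr (\<alpha> - 2)) (at s)"
        if "s \<in> {t (j - 1)<..<t j}" for s
        using that a pos by (auto intro!: derivative_eq_intros)
      show "((\<lambda>s. (\<alpha> - 1) * s powr (\<alpha> - 2)) has_real_derivative (\<alpha> - 1) * ((\<alpha> - 2) * s powr (\<alpha> - 3))) (at s)"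
        if "s \<in> {t (j - 1)<..<t j}" for s
        using that a pos by (auto intro!: derivative_eq_intros)
      show "\<bar>(\<alpha> - 1) * ((\<alpha> - 2) * s powr (\<alpha> - 3))\<bar> \<le> 2 * s powr (\<alpha> - 1 - 2)"
        if "s \<in> {t (j - 1)<..<t j}" for s
      proof -
        have "(1 - \<alpha>) * (2 - \<alpha>) \<le> 1 * 2" using \<alpha> by (intro mult_mono) auto
        then have "(1 - \<alpha>) * (2 - \<alpha>) * s powr (\<alpha> - 3) \<le> 2 * s powr (\<alpha> - 3)"
          by (intro mult_right_mono) auto
        then show ?thesis using \<alpha> by (simp add: abs_mult)
      qed
      show "?K integrable_on {t (j - 1)..t j}"
        using Kint by (rule integrable_on_subinterval) (use a in auto)
    qed (use a \<tau> \<alpha> in auto)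
    moreover have "?B j = t j powr (\<alpha> - 1)" "?B (j - 1) = t (j - 1) powr (\<alpha> - 1)"
      using a j k by (auto simp: plateau_barrier_def)
    ultimately show ?thesis by (simp add: l1_weight_def x_def abs_le_iff)
  qed
  have Kval: "(\<Sum>j=Suc k..m. integral {t (j - 1)..t j} ?K) = - ((x - \<sigma>) powr (1 - \<alpha>) * \<sigma> powr (\<alpha> - 1) / x)"
    using sum_mesh_integrals[OF mesh k(3), of k ?K] Kint k
      kernel_power_derivative_has_integral[OF \<alpha> pos(1), of x] \<tau>
    by (simp add: \<sigma>_def x_def integral_unique)
  have Esum: "(\<Sum>j=Suc k..m. integral {t (j - 1)..t j} ?E) = integral {\<sigma>..x} ?E"
    using sum_mesh_integrals[OF mesh k(3), of k ?E] Eint k by (simp add: \<sigma>_def x_def)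
  have after: "- ((x - \<sigma>) powr (1 - \<alpha>) * \<sigma> powr (\<alpha> - 1) / x) - ?C * integral {\<sigma>..x} ?E
      \<le> (\<Sum>j=Suc k..m. (?B j - ?B (j - 1)) * ?w j)"
  proof -
    have "(\<Sum>j=Suc k..m. integral {t (j - 1)..t j} ?K - ?C * integral {t (j - 1)..t j} ?E)
        \<le> (\<Sum>j=Suc k..m. (?B j - ?B (j - 1)) * ?w j)"
      by (rule sum_mono) (rule after_j)
    then show ?thesis unfolding sum_subtractf Kval Esum[symmetric] sum_distrib_left .
  qed
  have "{1..m} = {1..k} \<union> {Suc k..m}" using k by auto
  then have total: "l1_sum \<alpha> t ?B m = (\<Sum>j=1..k. (?B j - ?B (j - 1)) * ?w j)
      + (\<Sum>j=Suc k..m. (?B j - ?B (j - 1)) * ?w j)"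
    unfolding l1_sum_def by (simp add: sum.union_disjoint)
  let ?M = "\<sigma> powr \<alpha> * x powr (-\<alpha> - 1)"
  have x1: "x powr (-\<alpha>) = x * x powr (-\<alpha> - 1)" using powr_mult_base[of x "-\<alpha> - 1"] pos by simp
  have \<sigma>1: "\<sigma> powr \<alpha> = \<sigma> * \<sigma> powr (\<alpha> - 1)" using powr_mult_base[of \<sigma> "\<alpha> - 1"] pos by simp
  have main: "(1 - \<alpha>) * ?M \<le> x powr (-\<alpha>) * \<sigma> powr (\<alpha> - 1) - (x - \<sigma>) powr (1 - \<alpha>) * \<sigma> powr (\<alpha> - 1) / x"
  proof -
    obtain \<xi> where \<xi>: "0 < \<xi>" "\<xi> < \<sigma>"
      "integral {0..\<sigma>} (\<lambda>s. (x - s) powr (-\<alpha>)) / (\<sigma> - 0) = (x - \<xi>) powr (-\<alpha>)"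
      using kernel_mean_value[OF \<alpha> pos(1), of x] \<tau> by auto
    have "(x powr (1 - \<alpha>) - (x - \<sigma>) powr (1 - \<alpha>)) / (1 - \<alpha>) = \<sigma> * (x - \<xi>) powr (-\<alpha>)"
    proof -
      have "integral {0..\<sigma>} (\<lambda>s. (x - s) powr (-\<alpha>)) = \<sigma> * (x - \<xi>) powr (-\<alpha>)"
        using \<xi>(3) pos by (simp add: nonzero_divide_eq_eq mult.commute)
      then show ?thesis
        using integral_unique[OF kernel_has_integral[OF \<alpha>, of 0 \<sigma> x]] pos \<tau> by simp
    qed
    also have "\<dots> \<ge> \<sigma> * x powr (-\<alpha>)"
      using \<xi> \<tau> \<alpha> pos by (intro mult_left_mono powr_mono2') auto
    finally have "(1 - \<alpha>) * (\<sigma> * x powr (-\<alpha>)) \<le> x powr (1 - \<alpha>) - (x - \<sigma>) powr (1 - \<alpha>)"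
      using \<alpha> by (simp add: field_simps)
    then have "(1 - \<alpha>) * (\<sigma> * x powr (-\<alpha>)) * (\<sigma> powr (\<alpha> - 1) / x)
        \<le> (x powr (1 - \<alpha>) - (x - \<sigma>) powr (1 - \<alpha>)) * (\<sigma> powr (\<alpha> - 1) / x)"
      using pos by (intro mult_right_mono) auto
    moreover have "x powr (1 - \<alpha>) = x * x powr (-\<alpha>)" using powr_mult_base[of x "-\<alpha>"] pos by simp
    then have "(x powr (1 - \<alpha>) - (x - \<sigma>) powr (1 - \<alpha>)) * (\<sigma> powr (\<alpha> - 1) / x)
        = x powr (-\<alpha>) * \<sigma> powr (\<alpha> - 1) - (x - \<sigma>) powr (1 - \<alpha>) * \<sigma> powr (\<alpha> - 1) / x"
      using pos by (simp add: left_diff_distrib diff_divide_distrib)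
    moreover have "(1 - \<alpha>) * (\<sigma> * x powr (-\<alpha>)) * (\<sigma> powr (\<alpha> - 1) / x) = (1 - \<alpha>) * ?M"
      unfolding \<sigma>1 x1 using pos by simp
    ultimately show ?thesis by simp
  qed
  have err: "integral {\<sigma>..x} ?E \<le> ?M * ((1 / (2 / r - \<alpha>) + c) * (\<tau> / \<sigma>) powr \<alpha>)"
  proof -
    have "integral {\<sigma>..x} (\<lambda>s. \<tau> powr (2 / r) * s powr (\<alpha> - 1 - 2 / r))
        = \<tau> powr (2 / r) * ((\<sigma> powr (\<alpha> - 2 / r) - x powr (\<alpha> - 2 / r)) / (2 / r - \<alpha>))"
    proof -
      have "(x powr (\<alpha> - 2 / r) - \<sigma> powr (\<alpha> - 2 / r)) / (\<alpha> - 2 / r)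
          = (\<sigma> powr (\<alpha> - 2 / r) - x powr (\<alpha> - 2 / r)) / (2 / r - \<alpha>)"
        by (metis minus_diff_eq minus_divide_divide)
      then show ?thesis
        unfolding integral_mult_right
        using powr_has_integral_pos[OF pos(1), of x "\<alpha> - 1 - 2 / r"] \<tau> far_exp
        by (simp add: integral_unique)
    qed
    also have "\<dots> \<le> \<tau> powr (2 / r) * (\<sigma> powr (\<alpha> - 2 / r) / (2 / r - \<alpha>))"
      using far_exp by (intro mult_left_mono divide_right_mono) auto
    also have "\<dots> = \<sigma> powr \<alpha> * (1 / (2 / r - \<alpha>) * (\<tau> powr (2 / r) * \<sigma> powr (- (2 / r))))"
      using powr_add[of \<sigma> \<alpha> "- (2 / r)"] by simp
    also have "\<tau> powr (2 / r) * \<sigma> powr (- (2 / r)) = (\<tau> / \<sigma>) powr (2 / r)"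
      using ratio_powr \<tau> pos by simp
    also have "\<sigma> powr \<alpha> * (1 / (2 / r - \<alpha>) * (\<tau> / \<sigma>) powr (2 / r))
        \<le> \<sigma> powr \<alpha> * (1 / (2 / r - \<alpha>) * (\<tau> / \<sigma>) powr \<alpha>)"
      using far_exp \<tau> pos by (intro mult_left_mono powr_mono') auto
    finally have far: "integral {\<sigma>..x} (\<lambda>s. \<tau> powr (2 / r) * s powr (\<alpha> - 1 - 2 / r))
        \<le> \<sigma> powr \<alpha> * (1 / (2 / r - \<alpha>) * (\<tau> / \<sigma>) powr \<alpha>)" .
    have "\<tau> powr ((2 - \<alpha>) / r) * x powr (\<alpha> - 1 - \<alpha> - (2 - \<alpha>) / r)
        = x powr (-1) * (\<tau> powr ((2 - \<alpha>) / r) * x powr (- ((2 - \<alpha>) / r)))"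
      using powr_add[of x "-1" "- ((2 - \<alpha>) / r)"] by simp
    also have "\<tau> powr ((2 - \<alpha>) / r) * x powr (- ((2 - \<alpha>) / r)) = (\<tau> / x) powr ((2 - \<alpha>) / r)"
      using ratio_powr \<tau> pos by simp
    also have "x powr (-1) * (\<tau> / x) powr ((2 - \<alpha>) / r) \<le> x powr (-1) * (\<tau> / x) powr \<alpha>"
      using p0 \<tau> pos by (intro mult_left_mono powr_mono') auto
    also have "\<dots> = \<tau> powr \<alpha> * (x powr (-1) * x powr (-\<alpha>))"
      unfolding ratio_powr[OF \<tau>(1) pos(2), symmetric] by simp
    also have "x powr (-1) * x powr (-\<alpha>) = x powr (-\<alpha> - 1)"
      by (rule trans[OF powr_add[symmetric]]) (rule arg_cong[where f = "(powr) x"], simp)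
    also have "\<tau> powr \<alpha> * x powr (-\<alpha> - 1) = ?M * (\<tau> / \<sigma>) powr \<alpha>"
      using pos \<tau> by (simp add: powr_divide)
    finally have near: "\<tau> powr ((2 - \<alpha>) / r) * x powr (\<alpha> - 1 - \<alpha> - (2 - \<alpha>) / r) \<le> ?M * (\<tau> / \<sigma>) powr \<alpha>" .
    have "integral {\<sigma>..x} ?E \<le> x powr (-\<alpha> - 1) * (\<sigma> powr \<alpha> * (1 / (2 / r - \<alpha>) * (\<tau> / \<sigma>) powr \<alpha>))
        + c * (?M * (\<tau> / \<sigma>) powr \<alpha>)"
      using error_density_integral_le[OF \<alpha> \<tau>(1) pos(1), of x r "\<alpha> - 1"] \<tau>
        mult_left_mono[OF far powr_ge_zero[of x "-\<alpha> - 1"]] mult_left_mono[OF near c]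
      unfolding c_def by linarith
    then show ?thesis by (simp add: algebra_simps)
  qed
  have "?C * integral {\<sigma>..x} ?E \<le> ?C * (?M * ((1 / (2 / r - \<alpha>) + c) * (\<tau> / \<sigma>) powr \<alpha>))"
    using err L by (intro mult_left_mono) auto
  then have "(1 - \<alpha>) * ?M - ?C * (?M * ((1 / (2 / r - \<alpha>) + c) * (\<tau> / \<sigma>) powr \<alpha>)) \<le> l1_sum \<alpha> t ?B m"
    using main before after total by linarith
  moreover have "(1 - \<alpha>) * ?M - ?C * (?M * ((1 / (2 / r - \<alpha>) + c) * (\<tau> / \<sigma>) powr \<alpha>))
      = ?M * ((1 - \<alpha>) - ?C * (1 / (2 / r - \<alpha>) + c) * (\<tau> / \<sigma>) powr \<alpha>)"
    by (simp only: algebra_simps)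
  ultimately show ?thesis unfolding \<tau>_def \<sigma>_def x_def c_def by simp
qed


section \<open>Stability on refinements of graded meshes\<close>

lemma riemann_sum_le_integral:
  fixes t :: "nat \<Rightarrow> real" and q :: real
  assumes mesh: "is_mesh T N t" and i: "1 \<le> i" "i \<le> n" "n \<le> N" and q: "0 \<le> q"
  shows "(\<Sum>k=Suc i..n. (t k - t (k - 1)) * t k powr (- q)) \<le> integral {t i..t n} (\<lambda>s. s powr (- q))"
proof -
  have ti: "0 < t i" using mesh_pos[OF mesh] i by simp
  have int: "(\<lambda>s. s powr (- q)) integrable_on {t i..t n}"
    using ti by (auto intro!: integrable_continuous_real continuous_intros)
  have "(t k - t (k - 1)) * t k powr (- q) \<le> integral {t (k - 1)..t k} (\<lambda>s. s powr (- q))"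
    if k: "k \<in> {Suc i..n}" for k
  proof -
    have a: "t i \<le> t (k - 1)" "t (k - 1) \<le> t k"
      using mesh_le[OF mesh, of i "k - 1"] mesh_le[OF mesh, of "k - 1" k] k i by auto
    have "(t k - t (k - 1)) * t k powr (- q) = integral {t (k - 1)..t k} (\<lambda>s. t k powr (- q))"
      using a by simp
    also have "\<dots> \<le> integral {t (k - 1)..t k} (\<lambda>s. s powr (- q))"
      using a ti q by (intro integral_le powr_mono2')
        (auto intro!: integrable_continuous_real continuous_intros)
    finally show ?thesis .
  qed
  then have "(\<Sum>k=Suc i..n. (t k - t (k - 1)) * t k powr (- q))
      \<le> (\<Sum>k=Suc i..n. integral {t (k - 1)..t k} (\<lambda>s. s powr (- q)))"
    by (rule sum_mono)
  also have "\<dots> = integral {t i..t n} (\<lambda>s. s powr (- q))"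
    using sum_mesh_integrals[OF mesh i(3,2) int] .
  finally show ?thesis .
qed

text \<open>The sum telescopes, except that the interval containing \<open>b\<close> is counted in full.\<close>

lemma sum_steps_beyond_ge:
  fixes t :: "nat \<Rightarrow> real"
  assumes mesh: "is_mesh T N t" and b: "0 \<le> b" and "m \<le> N"
  shows "t m - b \<le> (\<Sum>k | k \<in> {1..m} \<and> b \<le> t k. t k - t (k - 1))"
  using \<open>m \<le> N\<close>
proof (induction m)
  case 0 then show ?case using mesh b by (simp add: is_mesh_def)
next
  case (Suc m)
  let ?S = "\<lambda>m. {k. k \<in> {1..m} \<and> b \<le> t k}"
  have nn: "0 \<le> (\<Sum>k\<in>?S n. t k - t (k - 1))" if "n \<le> N" for n
    using that mesh_le[OF mesh] by (intro sum_nonneg) auto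
  show ?case
  proof (cases "b \<le> t (Suc m)")
    case True
    then have S: "?S (Suc m) = insert (Suc m) (?S m)" by auto
    have "(\<Sum>k\<in>?S (Suc m). t k - t (k - 1)) = (t (Suc m) - t m) + (\<Sum>k\<in>?S m. t k - t (k - 1))"
      unfolding S by (subst sum.insert) auto
    then show ?thesis using Suc by linarith
  next
    case False
    then show ?thesis using nn[OF Suc.prems] by linarith
  qed
qed

text \<open>The barrier is a discrete version of $\int \tau^p \sigma^{-p} B_\sigma \,d\sigma$ for the plateau
barriers $B_\sigma$. At \<open>t m\<close> the plateaus with \<open>\<sigma> \<le> t m\<close> contribute
$t_m^{-\alpha-1} \tau^p \int^{t_m} \sigma^{\alpha-p}\,d\sigma \ge (\tau/t_m)^p$ up to a constant, since
$\sigma^{\alpha-p} \ge t_m^{\alpha-p}$. Only \<open>\<sigma> \<ge> k0 * \<tau>\<close> are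
allowed, so one further plateau barrier with \<open>\<sigma>\<close> of the order \<open>\<tau>\<close> takes care of \<open>t m < 2 * k0 * \<tau>\<close>, where
the right-hand side is of order one. The hypothesis on \<open>k0\<close> says that discretization costs each
plateau barrier at most half of its derivative.\<close>

lemma stability:
  fixes \<alpha> r T L C p c0 k0 :: real
  assumes \<alpha>: "0 < \<alpha>" "\<alpha> < 1" and r: "1 \<le> r" and L: "1 \<le> L" and C: "0 \<le> C"
    and p0: "\<alpha> \<le> (2 - \<alpha>) / r" and p: "\<alpha> < p"
    and k0: "2 \<le> k0" "16 * L\<^sup>2 * (1 + L) ^ 3 * (1 / (2 / r - \<alpha>) + (1 / \<alpha> + 1 / (1 - \<alpha>))) * (1 / k0) powr \<alpha>
                 \<le> (1 - \<alpha>) / 2"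
    and mesh: "is_mesh T N t"
    and width: "\<And>j. 2 \<le> j \<Longrightarrow> j \<le> N \<Longrightarrow> t j - t (j - 1) \<le> L * graded_step r (t 1) (t (j - 1))"
    and V0: "V 0 = 0"
    and V: "\<And>m. 1 \<le> m \<Longrightarrow> m \<le> N \<Longrightarrow> \<bar>l1_sum \<alpha> t V m\<bar> \<le> C * (t 1 / t m) powr p"
    and m: "1 \<le> m" "m \<le> N"
  shows "\<bar>V m\<bar> \<le> 8 * k0 * (1 + L) / (1 - \<alpha>) * C *
           (t 1 * t m powr (\<alpha> - 1)
            + t 1 powr p * t m powr (\<alpha> - 1) * integral {t 1..t m} (\<lambda>s. s powr (- p))
            + t 1 powr p * t m powr (\<alpha> - p) / (p - \<alpha>))"
proof -
  define \<tau> c0 c1 where "\<tau> = t 1" and "c0 = (1 - \<alpha>) / 2" and "c1 = (1 - \<alpha>) / (8 * k0 * (1 + L))"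
  have t0: "t 0 = 0" "t N = T" "1 \<le> N" using mesh by (auto simp: is_mesh_def)
  have \<tau>: "0 < \<tau>" using mesh_pos[OF mesh, of 1] t0 by (simp add: \<tau>_def)
  have \<tau>_le: "\<tau> \<le> t n" if "1 \<le> n" "n \<le> N" for n using mesh_le[OF mesh that] by (simp add: \<tau>_def)
  have pos: "0 < t n" if "1 \<le> n" "n \<le> N" for n using mesh_pos[OF mesh that] .
  have c0: "0 < c0" "c0 \<le> 1" using \<alpha> by (auto simp: c0_def)
  have c1: "0 < c1" using \<alpha> k0 L by (simp add: c1_def)
  have k0\<tau>: "0 < k0 * \<tau>" "\<tau> < k0 * \<tau>" using k0 \<tau> by auto
  let ?C = "16 * L\<^sup>2 * (1 + L) ^ 3 * (1 / (2 / r - \<alpha>) + (1 / \<alpha> + 1 / (1 - \<alpha>)))"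
  have Cnn: "0 \<le> ?C"
  proof -
    have "(2 - \<alpha>) / r < 2 / r" using \<alpha> r by (intro divide_strict_right_mono) auto
    then have "0 \<le> 1 / (2 / r - \<alpha>) + (1 / \<alpha> + 1 / (1 - \<alpha>))" using p0 \<alpha> by simp
    then show ?thesis using L by (intro mult_nonneg_nonneg) auto
  qed
  have after: "c0 * (t k powr \<alpha> * t n powr (-\<alpha> - 1)) \<le> l1_sum \<alpha> t (plateau_barrier \<alpha> t (t k)) n"
    if k: "1 \<le> k" "k0 * \<tau> \<le> t k" "k \<le> n" "n \<le> N" for k n
  proof (cases "k = n")
    case True
    have "c0 * (t n powr \<alpha> * t n powr (-\<alpha> - 1)) \<le> 1 * (t n powr \<alpha> * t n powr (-\<alpha> - 1))"
      using c0 by (intro mult_right_mono) auto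
    also have "\<dots> = t n powr (-\<alpha>) * t n powr (\<alpha> - 1)" by (simp flip: powr_add)
    also have "\<dots> \<le> l1_sum \<alpha> t (plateau_barrier \<alpha> t (t n)) n"
      using plateau_barrier_before[OF \<alpha> mesh] k by simp
    finally show ?thesis using True by simp
  next
    case False
    have "(\<tau> / t k) powr \<alpha> \<le> (1 / k0) powr \<alpha>"
    proof (rule powr_mono2)
      show "\<tau> / t k \<le> 1 / k0" using k k0 pos[of k] by (simp add: field_simps)
      show "0 \<le> \<tau> / t k" using \<tau> pos[of k] k by simp
    qed (use \<alpha> in auto)
    then have "?C * (\<tau> / t k) powr \<alpha> \<le> ?C * (1 / k0) powr \<alpha>" using Cnn by (rule mult_left_mono)
    then have "c0 \<le> (1 - \<alpha>) - ?C * (t 1 / t k) powr \<alpha>"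
      using k0(2) unfolding c0_def \<tau>_def by argo
    then have "t k powr \<alpha> * t n powr (-\<alpha> - 1) * c0
        \<le> t k powr \<alpha> * t n powr (-\<alpha> - 1) * ((1 - \<alpha>) - ?C * (t 1 / t k) powr \<alpha>)"
      by (intro mult_left_mono) auto
    also have "\<dots> \<le> l1_sum \<alpha> t (plateau_barrier \<alpha> t (t k)) n"
      using plateau_barrier_after[OF \<alpha> r L p0 mesh k(1) _ k(4) width] k False by simp
    finally show ?thesis by (simp add: mult.commute)
  qed
  have nonneg: "0 \<le> l1_sum \<alpha> t (plateau_barrier \<alpha> t (t k)) n"
    if k: "1 \<le> k" "k \<le> N" "k0 * \<tau> \<le> t k" "1 \<le> n" "n \<le> N" for k n
  proof (cases "k \<le> n")
    case True
    have "0 \<le> c0 * (t k powr \<alpha> * t n powr (-\<alpha> - 1))" using c0 by simp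
    then show ?thesis using after[of k n] True k by linarith
  next
    case False
    have "0 \<le> t n powr (-\<alpha>) * t k powr (\<alpha> - 1)" by simp
    then show ?thesis
      using plateau_barrier_before[OF \<alpha> mesh, of n "t k"] mesh_le[OF mesh, of n k] False k by linarith
  qed
  \<comment> \<open>The plateau length for small times is the first node beyond \<open>k0 * \<tau>\<close>. If the whole time interval is
      shorter than that, the barrier is constant on all of it and needs no node.\<close>
  obtain \<sigma> where \<sigma>: "k0 * \<tau> \<le> \<sigma>" "\<sigma> \<le> (1 + L) * (k0 * \<tau>)" "(\<exists>k\<in>{1..N}. \<sigma> = t k) \<or> T \<le> \<sigma>"
  proof (cases "k0 * \<tau> \<le> T")
    case False
    have "k0 * \<tau> \<le> (1 + L) * (k0 * \<tau>)" using k0\<tau> L by (simp add: mult_le_cancel_right1)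
    then show ?thesis using that[of "k0 * \<tau>"] False by auto
  next
    case True
    define k where "k = (LEAST k. k0 * \<tau> \<le> t k)"
    have k: "k0 * \<tau> \<le> t k" "k \<le> N"
      using True t0 LeastI[of "\<lambda>k. k0 * \<tau> \<le> t k" N] Least_le[of "\<lambda>k. k0 * \<tau> \<le> t k" N] by (auto simp: k_def)
    have "k \<noteq> 0" using k(1) k0\<tau>(1) t0(1) by (metis leD)
    moreover have "k \<noteq> 1" using k(1) k0\<tau>(2) by (metis \<tau>_def leD)
    ultimately have k2: "2 \<le> k" by simp
    have prev: "t (k - 1) < k0 * \<tau>"
      using not_less_Least[of "k - 1" "\<lambda>k. k0 * \<tau> \<le> t k"] k2 by (auto simp: k_def)
    have "t k \<le> t (k - 1) + L * graded_step r \<tau> (t (k - 1))"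
      using width[OF k2 k(2)] by (simp add: \<tau>_def)
    also have "\<dots> \<le> t (k - 1) + L * t (k - 1)"
      using graded_step_le[OF r \<tau> \<tau>_le[of "k - 1"]] k k2 L by (intro add_left_mono mult_left_mono) auto
    also have "\<dots> = (1 + L) * t (k - 1)" by (simp add: algebra_simps)
    also have "\<dots> \<le> (1 + L) * (k0 * \<tau>)" using prev L by (intro mult_left_mono) auto
    finally show ?thesis using that[of "t k"] k k2 by force
  qed
  have \<sigma>0: "0 < \<sigma>" using \<sigma> k0\<tau> by linarith
  have \<sigma>_before: "t n powr (-\<alpha>) * \<sigma> powr (\<alpha> - 1) \<le> l1_sum \<alpha> t (plateau_barrier \<alpha> t \<sigma>) n"
    if "1 \<le> n" "n \<le> N" "t n \<le> \<sigma>" for n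
    using plateau_barrier_before[OF \<alpha> mesh that] .
  have \<sigma>_after: "c0 * (\<sigma> powr \<alpha> * t n powr (-\<alpha> - 1)) \<le> l1_sum \<alpha> t (plateau_barrier \<alpha> t \<sigma>) n"
    if n: "1 \<le> n" "n \<le> N" "\<sigma> \<le> t n" for n
  proof (cases "\<exists>k\<in>{1..N}. \<sigma> = t k")
    case True
    then obtain k where k: "1 \<le> k" "k \<le> N" "\<sigma> = t k" by auto
    have "k \<le> n" using mesh_less[OF mesh, of n k] k n by (meson leD leI)
    then show ?thesis using after[of k n] k n \<sigma> by simp
  next
    case False
    then have "t n = \<sigma>" "T \<le> \<sigma>" using \<sigma> n mesh_le[OF mesh, of n N] t0 by auto
    then have "n = N" using mesh_less[OF mesh, of n N] n t0 by force
    then show ?thesis using False n t0 \<open>t n = \<sigma>\<close> by force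
  qed
  have \<sigma>_nonneg: "0 \<le> l1_sum \<alpha> t (plateau_barrier \<alpha> t \<sigma>) n" if "1 \<le> n" "n \<le> N" for n
  proof (cases "t n \<le> \<sigma>")
    case True
    have "0 \<le> t n powr (-\<alpha>) * \<sigma> powr (\<alpha> - 1)" by simp
    then show ?thesis using \<sigma>_before[OF that True] by linarith
  next
    case False
    have "0 \<le> c0 * (\<sigma> powr \<alpha> * t n powr (-\<alpha> - 1))" using c0 by simp
    then show ?thesis using \<sigma>_after[OF that] False by linarith
  qed
  define S where "S = {k. k \<in> {1..N} \<and> k0 * \<tau> \<le> t k}"
  define a where "a = (\<lambda>k. (t k - t (k - 1)) * (\<tau> powr p * t k powr (- p)))"
  define W where "W = (\<lambda>j. \<tau> * plateau_barrier \<alpha> t \<sigma> j + (\<Sum>k\<in>S. a k * plateau_barrier \<alpha> t (t k) j))"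
  have S: "finite S" by (simp add: S_def)
  have a: "0 \<le> a k" if "k \<in> {1..N}" for k
    using that mesh_le[OF mesh, of "k - 1" k] by (simp add: a_def)
  have l1W: "l1_sum \<alpha> t W n = \<tau> * l1_sum \<alpha> t (plateau_barrier \<alpha> t \<sigma>) n
      + (\<Sum>k\<in>S. a k * l1_sum \<alpha> t (plateau_barrier \<alpha> t (t k)) n)" for n
    unfolding W_def by (simp add: l1_sum_add l1_sum_cmult l1_sum_sum[OF S])
  \<comment> \<open>For large times the sum over the plateaus that end by \<open>t n\<close> suffices; for small times the single
      extra plateau does.\<close>
  have lower: "c1 * (\<tau> / t n) powr p \<le> l1_sum \<alpha> t W n" if n: "1 \<le> n" "n \<le> N" for n
  proof (cases "2 * (k0 * \<tau>) \<le> t n")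
    case True
    let ?S = "{k. k \<in> {1..n} \<and> k0 * \<tau> \<le> t k}"
    let ?c = "c0 * \<tau> powr p * t n powr (-1 - p)"
    have x: "0 < t n" using pos n by simp
    have summand: "?c * (t k - t (k - 1)) \<le> a k * l1_sum \<alpha> t (plateau_barrier \<alpha> t (t k)) n" if k: "k \<in> ?S" for k
    proof -
      have tk: "0 < t k" "t k \<le> t n" using pos[of k] mesh_le[OF mesh, of k n] k n by auto
      have "t n powr (\<alpha> - p) \<le> t k powr (\<alpha> - p)" using tk p by (intro powr_mono2') auto
      then have le: "c0 * \<tau> powr p * t n powr (-\<alpha> - 1) * (t k - t (k - 1)) * t n powr (\<alpha> - p)
          \<le> c0 * \<tau> powr p * t n powr (-\<alpha> - 1) * (t k - t (k - 1)) * t k powr (\<alpha> - p)"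
        using c0 k n mesh_le[OF mesh, of "k - 1" k] by (intro mult_left_mono) auto
      have n_split: "t n powr (-1 - p) = t n powr (-\<alpha> - 1) * t n powr (\<alpha> - p)"
        by (simp flip: powr_add)
      have k_split: "t k powr (\<alpha> - p) = t k powr (- p) * t k powr \<alpha>"
        by (simp flip: powr_add)
      have "?c * (t k - t (k - 1)) \<le> a k * (c0 * (t k powr \<alpha> * t n powr (-\<alpha> - 1)))"
        using le unfolding a_def n_split k_split by (simp only: mult_ac)
      also have "\<dots> \<le> a k * l1_sum \<alpha> t (plateau_barrier \<alpha> t (t k)) n"
        using after[of k n] k n a[of k] by (intro mult_left_mono) auto
      finally show ?thesis .
    qed
    have "c0 / 2 * (\<tau> powr p * t n powr (- p)) = ?c * (t n / 2)"
      using powr_mult_base[of "t n" "-1 - p"] x by (simp add: mult_ac)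
    also have "\<dots> \<le> ?c * (t n - k0 * \<tau>)" using True c0 by (intro mult_left_mono) auto
    also have "\<dots> \<le> ?c * (\<Sum>k\<in>?S. t k - t (k - 1))"
      using sum_steps_beyond_ge[OF mesh _ n(2), of "k0 * \<tau>"] k0\<tau> c0 by (intro mult_left_mono) auto
    also have "\<dots> \<le> (\<Sum>k\<in>?S. a k * l1_sum \<alpha> t (plateau_barrier \<alpha> t (t k)) n)"
      unfolding sum_distrib_left by (intro sum_mono summand)
    also have "\<dots> \<le> (\<Sum>k\<in>S. a k * l1_sum \<alpha> t (plateau_barrier \<alpha> t (t k)) n)"
      using n a nonneg by (intro sum_mono2[OF S]) (auto simp: S_def)
    also have "\<dots> \<le> l1_sum \<alpha> t W n" unfolding l1W using \<sigma>_nonneg[OF n] \<tau> by simp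
    finally have "c0 / 2 * (\<tau> / t n) powr p \<le> l1_sum \<alpha> t W n"
      using ratio_powr[OF \<tau> x, of p] by simp
    moreover have "c1 \<le> c0 / 2"
    proof -
      have "1 * 1 \<le> k0 * (1 + L)" using k0 L by (intro mult_mono) auto
      then have "(1 - \<alpha>) / (8 * k0 * (1 + L)) \<le> (1 - \<alpha>) / 4"
        using \<alpha> k0 L by (intro divide_left_mono) (auto simp: mult.assoc)
      then show ?thesis by (simp add: c1_def c0_def)
    qed
    then have "c1 * (\<tau> / t n) powr p \<le> c0 / 2 * (\<tau> / t n) powr p" by (intro mult_right_mono) auto
    ultimately show ?thesis by linarith
  next
    case False
    have x: "0 < t n" using pos n by simp
    have "(\<tau> / t n) powr p \<le> 1"
      using \<tau>_le[OF n] \<tau> x p \<alpha> by (intro powr_le1) auto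
    then have "c1 * (\<tau> / t n) powr p \<le> c1" using c1 by (simp add: mult_left_le)
    also have "c1 \<le> \<tau> * l1_sum \<alpha> t (plateau_barrier \<alpha> t \<sigma>) n"
    proof (cases "t n \<le> \<sigma>")
      case True
      have "c1 \<le> 1 / (k0 * (1 + L))"
        unfolding c1_def using \<alpha> k0 L by (simp add: frac_le)
      also have "\<dots> = \<tau> / ((1 + L) * (k0 * \<tau>))" using \<tau> by (simp add: mult_ac)
      also have "\<dots> \<le> \<tau> / \<sigma>" using \<sigma> \<sigma>0 \<tau> by (intro divide_left_mono) auto
      also have "\<dots> = \<tau> * (\<sigma> powr (-\<alpha>) * \<sigma> powr (\<alpha> - 1))"
        using \<sigma>0 powr_minus_divide[of \<sigma> 1] by (simp flip: powr_add)
      also have "\<dots> \<le> \<tau> * (t n powr (-\<alpha>) * \<sigma> powr (\<alpha> - 1))"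
        using True x \<alpha> \<tau> by (intro mult_left_mono mult_right_mono powr_mono2') auto
      also have "\<dots> \<le> \<tau> * l1_sum \<alpha> t (plateau_barrier \<alpha> t \<sigma>) n"
        using \<sigma>_before[OF n True] \<tau> by (intro mult_left_mono) auto
      finally show ?thesis .
    next
      case after\<sigma>: False
      have kk: "0 < k0" "0 < 2 * (k0 * \<tau>)" using k0 k0\<tau> by auto
      have "c1 \<le> c0 / (4 * k0)"
      proof -
        have "4 * k0 * 1 \<le> 4 * k0 * (1 + L)" using k0 L by (intro mult_left_mono) auto
        then have "c0 / (4 * k0 * (1 + L)) \<le> c0 / (4 * k0)"
          using c0 k0 L by (intro divide_left_mono) auto
        then show ?thesis unfolding c1_def c0_def by (simp add: mult_ac)
      qed
      also have "\<dots> = c0 * (\<tau> / (4 * (k0 * \<tau>)))" using \<tau> by simp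
      also have "\<dots> \<le> c0 * (\<tau> * ((k0 * \<tau>) powr \<alpha> * (2 * (k0 * \<tau>)) powr (-\<alpha> - 1)))"
      proof -
        have "(2 * (k0 * \<tau>)) powr (-\<alpha> - 1) = 2 powr (-\<alpha> - 1) * (k0 * \<tau>) powr (-\<alpha> - 1)"
          using kk by (intro powr_mult) 
        then have "(k0 * \<tau>) powr \<alpha> * (2 * (k0 * \<tau>)) powr (-\<alpha> - 1)
            = 2 powr (-\<alpha> - 1) * ((k0 * \<tau>) powr \<alpha> * (k0 * \<tau>) powr (-\<alpha> - 1))" by simp
        also have "(k0 * \<tau>) powr \<alpha> * (k0 * \<tau>) powr (-\<alpha> - 1) = 1 / (k0 * \<tau>)"
          using k0\<tau> powr_minus_divide[of "k0 * \<tau>" 1] by (simp flip: powr_add)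
        also have "2 powr (-\<alpha> - 1) * (1 / (k0 * \<tau>)) \<ge> 2 powr (-2) * (1 / (k0 * \<tau>))"
          using k0\<tau> \<alpha> by (intro mult_right_mono powr_mono) auto
        finally have "1 / (4 * (k0 * \<tau>)) \<le> (k0 * \<tau>) powr \<alpha> * (2 * (k0 * \<tau>)) powr (-\<alpha> - 1)"
          by (simp add: powr_minus)
        then have "\<tau> * (1 / (4 * (k0 * \<tau>))) \<le> \<tau> * ((k0 * \<tau>) powr \<alpha> * (2 * (k0 * \<tau>)) powr (-\<alpha> - 1))"
          using \<tau> by (intro mult_left_mono) auto
        then show ?thesis using c0 by (simp add: mult_left_mono)
      qed
      also have "\<dots> \<le> c0 * (\<tau> * (\<sigma> powr \<alpha> * t n powr (-\<alpha> - 1)))"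
        using \<sigma> False x k0\<tau> \<alpha> c0 \<tau> by (intro mult_left_mono mult_mono powr_mono2 powr_mono2') auto
      also have "\<dots> \<le> \<tau> * l1_sum \<alpha> t (plateau_barrier \<alpha> t \<sigma>) n"
        using \<sigma>_after[OF n] after\<sigma> \<tau> mult_left_mono[of "c0 * (\<sigma> powr \<alpha> * t n powr (-\<alpha> - 1))" _ \<tau>]
        by (simp add: mult.left_commute)
      finally show ?thesis .
    qed
    also have "\<dots> \<le> l1_sum \<alpha> t W n"
    proof -
      have "0 \<le> (\<Sum>k\<in>S. a k * l1_sum \<alpha> t (plateau_barrier \<alpha> t (t k)) n)"
        using n a nonneg by (intro sum_nonneg mult_nonneg_nonneg) (auto simp: S_def)
      then show ?thesis unfolding l1W by simp
    qed
    finally show ?thesis .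
  qed
  have W0: "W 0 = 0" by (simp add: W_def plateau_barrier_def)
  have "\<bar>V m\<bar> \<le> C / c1 * W m"
  proof (rule l1_comparison[OF \<alpha> mesh, where V = V and B = "\<lambda>j. C / c1 * W j"])
    fix n assume n: "1 \<le> n" "n \<le> N"
    have "\<bar>l1_sum \<alpha> t V n\<bar> \<le> C / c1 * (c1 * (\<tau> / t n) powr p)" using V[OF n] c1 by (simp add: \<tau>_def)
    also have "\<dots> \<le> C / c1 * l1_sum \<alpha> t W n" using lower[OF n] C c1 by (intro mult_left_mono) auto
    finally show "\<bar>l1_sum \<alpha> t V n\<bar> \<le> l1_sum \<alpha> t (\<lambda>j. C / c1 * W j) n"
      unfolding l1_sum_cmult .
  qed (use W0 V0 m in simp_all)
  also have "\<dots> \<le> C / c1 * (\<tau> * t m powr (\<alpha> - 1)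
            + \<tau> powr p * t m powr (\<alpha> - 1) * integral {\<tau>..t m} (\<lambda>s. s powr (- p))
            + \<tau> powr p * t m powr (\<alpha> - p) / (p - \<alpha>))"
  proof (rule mult_left_mono)
    have x: "0 < t m" using pos m by simp
    \<comment> \<open>Plateaus that end by \<open>t m\<close> all have the value \<open>t m powr (\<alpha> - 1)\<close> at \<open>m\<close>, the later ones still
        sit on their plateau; both sums are right Riemann sums of decreasing functions.\<close>
    have first: "plateau_barrier \<alpha> t \<sigma> m \<le> t m powr (\<alpha> - 1)"
      using m x \<alpha> by (auto simp: plateau_barrier_def intro!: powr_mono2')
    \<comment> \<open>The first node is excluded by \<open>k0 > 1\<close>; otherwise the Riemann sum would start at \<open>0\<close>, where
        \<open>s powr (- p)\<close> need not be integrable.\<close>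
    have S2: "S \<subseteq> {2..m} \<union> {Suc m..N}"
    proof
      fix k assume k: "k \<in> S"
      then have "k \<noteq> 1" using k0\<tau> by (auto simp: S_def \<tau>_def)
      then show "k \<in> {2..m} \<union> {Suc m..N}" using k by (auto simp: S_def)
    qed
    have "(\<Sum>k\<in>S. a k * plateau_barrier \<alpha> t (t k) m)
        \<le> (\<Sum>k\<in>{2..m} \<union> {Suc m..N}. a k * plateau_barrier \<alpha> t (t k) m)"
      using m a by (intro sum_mono2 S2) (auto simp: plateau_barrier_def)
    also have "\<dots> = (\<Sum>k=2..m. a k * plateau_barrier \<alpha> t (t k) m)
        + (\<Sum>k=Suc m..N. a k * plateau_barrier \<alpha> t (t k) m)"
      by (intro sum.union_disjoint) auto
    also have "(\<Sum>k=2..m. a k * plateau_barrier \<alpha> t (t k) m)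
        = (\<tau> powr p * t m powr (\<alpha> - 1)) * (\<Sum>k=Suc 1..m. (t k - t (k - 1)) * t k powr (- p))"
      unfolding sum_distrib_left
    proof (rule sum.cong)
      fix k assume "k \<in> {Suc 1..m}"
      then have "t k \<le> t m" using mesh_le[OF mesh, of k m] m by auto
      then show "a k * plateau_barrier \<alpha> t (t k) m
          = \<tau> powr p * t m powr (\<alpha> - 1) * ((t k - t (k - 1)) * t k powr (- p))"
        using m by (simp add: a_def plateau_barrier_def max_absorb1)
    qed auto
    also have "(\<Sum>k=Suc m..N. a k * plateau_barrier \<alpha> t (t k) m)
        = \<tau> powr p * (\<Sum>k=Suc m..N. (t k - t (k - 1)) * t k powr (- (p + 1 - \<alpha>)))"
      unfolding sum_distrib_left
    proof (rule sum.cong)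
      fix k assume k: "k \<in> {Suc m..N}"
      then have "t m \<le> t k" using mesh_le[OF mesh, of m k] m by auto
      moreover have "t k powr (- p) * t k powr (\<alpha> - 1) = t k powr (- (p + 1 - \<alpha>))"
        by (simp add: algebra_simps flip: powr_add)
      ultimately show "a k * plateau_barrier \<alpha> t (t k) m
          = \<tau> powr p * ((t k - t (k - 1)) * t k powr (- (p + 1 - \<alpha>)))"
        using m by (simp add: a_def plateau_barrier_def max_absorb2 mult.assoc)
    qed auto
    also have "(\<tau> powr p * t m powr (\<alpha> - 1)) * (\<Sum>k=Suc 1..m. (t k - t (k - 1)) * t k powr (- p))
        \<le> (\<tau> powr p * t m powr (\<alpha> - 1)) * integral {t 1..t m} (\<lambda>s. s powr (- p))"
      using p \<alpha> m by (intro mult_left_mono riemann_sum_le_integral[OF mesh]) auto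
    also have "\<tau> powr p * (\<Sum>k=Suc m..N. (t k - t (k - 1)) * t k powr (- (p + 1 - \<alpha>)))
        \<le> \<tau> powr p * (t m powr (\<alpha> - p) / (p - \<alpha>))"
    proof (rule mult_left_mono)
      have "(\<Sum>k=Suc m..N. (t k - t (k - 1)) * t k powr (- (p + 1 - \<alpha>)))
          \<le> integral {t m..T} (\<lambda>s. s powr (- (p + 1 - \<alpha>)))"
        using riemann_sum_le_integral[OF mesh m order_refl, of "p + 1 - \<alpha>"] p \<alpha> t0 by simp
      also have "\<dots> = (T powr (\<alpha> - p) - t m powr (\<alpha> - p)) / (\<alpha> - p)"
        using powr_has_integral_pos[OF x, of T "- (p + 1 - \<alpha>)"] mesh_le[OF mesh m(2)] p t0
        by (simp add: integral_unique algebra_simps)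
      also have "\<dots> = (t m powr (\<alpha> - p) - T powr (\<alpha> - p)) / (p - \<alpha>)"
        by (metis minus_diff_eq minus_divide_divide)
      also have "\<dots> \<le> t m powr (\<alpha> - p) / (p - \<alpha>)" using p by (intro divide_right_mono) auto
      finally show "(\<Sum>k=Suc m..N. (t k - t (k - 1)) * t k powr (- (p + 1 - \<alpha>))) \<le> t m powr (\<alpha> - p) / (p - \<alpha>)" .
    qed simp
    finally show "W m \<le> \<tau> * t m powr (\<alpha> - 1)
        + \<tau> powr p * t m powr (\<alpha> - 1) * integral {\<tau>..t m} (\<lambda>s. s powr (- p))
        + \<tau> powr p * t m powr (\<alpha> - p) / (p - \<alpha>)"
      using mult_left_mono[OF first less_imp_le[OF \<tau>]] unfolding W_def \<tau>_def times_divide_eq_right by linarith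
  qed (use C c1 in simp)
  also have "C / c1 = 8 * k0 * (1 + L) / (1 - \<alpha>) * C" by (simp add: c1_def)
  finally show ?thesis unfolding \<tau>_def .
qed


text \<open>The error bound expressed through the first mesh width \<open>\<tau>\<close> in place of \<open>M powr (- r)\<close>.\<close>

definition convergence_rate :: "real \<Rightarrow> real \<Rightarrow> real \<Rightarrow> real \<Rightarrow> real" where
  "convergence_rate \<alpha> r \<tau> x =
     (if r < 2 - \<alpha> then \<tau> * x powr (\<alpha> - 1)
      else if r = 2 - \<alpha> then \<tau> * x powr (\<alpha> - 1) * (1 + ln (x / \<tau>))
      else \<tau> powr ((2 - \<alpha>) / r) * x powr (\<alpha> - (2 - \<alpha>) / r))"

text \<open>The three regimes are those of \<open>p > 1\<close>, \<open>p = 1\<close> and \<open>p < 1\<close> in the integral of \<open>s powr (- p)\<close>, which is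
then dominated by its lower limit, logarithmic, or dominated by its upper limit. For \<open>p = 1\<close> the term
\<open>1 / \<bar>1 - p\<bar>\<close> of the constant is \<open>0\<close>; the integral then is the logarithm that occurs in the rate itself.\<close>

lemma barrier_bound_le_convergence_rate:
  fixes \<alpha> r \<tau> x p :: real
  assumes \<alpha>: "0 < \<alpha>" "\<alpha> < 1" and r: "1 \<le> r" and \<tau>: "0 < \<tau>" "\<tau> \<le> x" and p: "\<alpha> < p"
    and p_def: "p = min (1 + \<alpha> / 2) ((2 - \<alpha>) / r)"
  shows "\<tau> * x powr (\<alpha> - 1) + \<tau> powr p * x powr (\<alpha> - 1) * integral {\<tau>..x} (\<lambda>s. s powr (- p))
           + \<tau> powr p * x powr (\<alpha> - p) / (p - \<alpha>)
         \<le> (1 + 1 / \<bar>1 - p\<bar> + 1 / (p - \<alpha>)) * convergence_rate \<alpha> r \<tau> x"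
proof -
  have x: "0 < x" using \<tau> by simp
  have split_x: "x powr (\<alpha> - p) = x powr (\<alpha> - 1) * x powr (1 - p)" by (simp flip: powr_add)
  have split_\<tau>: "\<tau> = \<tau> powr p * \<tau> powr (1 - p)" using \<tau> by (simp flip: powr_add)
  have pa: "0 < 1 / (p - \<alpha>)" using p by simp
  consider "r < 2 - \<alpha>" | "r = 2 - \<alpha>" | "2 - \<alpha> < r" by linarith
  then show ?thesis
  proof cases
    case 1
    have p1: "1 < p" using 1 r \<alpha> by (simp add: p_def less_divide_eq)
    let ?R = "\<tau> * x powr (\<alpha> - 1)"
    have "integral {\<tau>..x} (\<lambda>s. s powr (- p)) = (x powr (1 - p) - \<tau> powr (1 - p)) / (1 - p)"
      using powr_has_integral_pos[OF \<tau>, of "- p"] p1 by (simp add: integral_unique)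
    also have "\<dots> = (\<tau> powr (1 - p) - x powr (1 - p)) / (p - 1)"
      by (metis minus_diff_eq minus_divide_divide)
    also have "\<dots> \<le> \<tau> powr (1 - p) / (p - 1)" using p1 by (intro divide_right_mono) auto
    finally have "\<tau> powr p * x powr (\<alpha> - 1) * integral {\<tau>..x} (\<lambda>s. s powr (- p))
        \<le> \<tau> powr p * x powr (\<alpha> - 1) * (\<tau> powr (1 - p) / (p - 1))"
      by (intro mult_left_mono) auto
    also have "\<dots> = (\<tau> powr p * \<tau> powr (1 - p)) * x powr (\<alpha> - 1) * (1 / (p - 1))" by simp
    finally have I: "\<tau> powr p * x powr (\<alpha> - 1) * integral {\<tau>..x} (\<lambda>s. s powr (- p)) \<le> ?R * (1 / (p - 1))"
      unfolding split_\<tau>[symmetric] .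
    have "x powr (1 - p) \<le> \<tau> powr (1 - p)" using \<tau> p1 by (intro powr_mono2') auto
    then have "\<tau> powr p * (x powr (\<alpha> - 1) * x powr (1 - p)) \<le> \<tau> powr p * (x powr (\<alpha> - 1) * \<tau> powr (1 - p))"
      by (intro mult_left_mono) auto
    also have "\<dots> = (\<tau> powr p * \<tau> powr (1 - p)) * x powr (\<alpha> - 1)" by simp
    finally have J: "\<tau> powr p * x powr (\<alpha> - p) \<le> ?R" unfolding split_\<tau>[symmetric] split_x .
    have "\<tau> powr p * x powr (\<alpha> - p) / (p - \<alpha>) \<le> ?R / (p - \<alpha>)"
      using J p by (intro divide_right_mono) auto
    then show ?thesis using I 1 p1 by (simp add: convergence_rate_def algebra_simps)
  next
    case 2
    have p1: "p = 1" using 2 \<alpha> by (simp add: p_def)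
    let ?R = "\<tau> * x powr (\<alpha> - 1)"
    have "((\<lambda>s. s powr (-1)) has_integral (ln x - ln \<tau>)) {\<tau>..x}"
      using \<tau> by (intro fundamental_theorem_of_calculus)
        (auto intro!: derivative_eq_intros simp: powr_minus field_simps
          simp flip: has_real_derivative_iff_has_vector_derivative)
    then have "integral {\<tau>..x} (\<lambda>s. s powr (- p)) = ln (x / \<tau>)"
      using \<tau> x by (simp add: p1 integral_unique ln_div)
    moreover have "0 \<le> ln (x / \<tau>)" using \<tau> by simp
    moreover have "0 \<le> ?R * (1 / (1 - \<alpha>) * ln (x / \<tau>))"
      using \<tau> \<alpha> \<open>0 \<le> ln (x / \<tau>)\<close> by (intro mult_nonneg_nonneg) auto
    ultimately show ?thesis using 2 \<tau> by (simp add: convergence_rate_def p1 algebra_simps)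
  next
    case 3
    have "(2 - \<alpha>) / r < 1" using 3 r by (simp add: divide_less_eq)
    then have p1: "p = (2 - \<alpha>) / r" "p < 1" using \<alpha> by (simp_all add: p_def)
    let ?R = "\<tau> powr p * x powr (\<alpha> - p)"
    have "integral {\<tau>..x} (\<lambda>s. s powr (- p)) = (x powr (1 - p) - \<tau> powr (1 - p)) / (1 - p)"
      using powr_has_integral_pos[OF \<tau>, of "- p"] p1(2) by (simp add: integral_unique)
    also have "\<dots> \<le> x powr (1 - p) / (1 - p)" using p1(2) by (intro divide_right_mono) auto
    finally have "\<tau> powr p * x powr (\<alpha> - 1) * integral {\<tau>..x} (\<lambda>s. s powr (- p))
        \<le> \<tau> powr p * x powr (\<alpha> - 1) * (x powr (1 - p) / (1 - p))"
      by (intro mult_left_mono) auto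
    then have I: "\<tau> powr p * x powr (\<alpha> - 1) * integral {\<tau>..x} (\<lambda>s. s powr (- p)) \<le> ?R * (1 / (1 - p))"
      unfolding split_x by simp
    have "\<tau> powr (1 - p) \<le> x powr (1 - p)" using \<tau> p1(2) by (intro powr_mono2) auto
    then have "\<tau> powr p * (x powr (\<alpha> - 1) * \<tau> powr (1 - p)) \<le> \<tau> powr p * (x powr (\<alpha> - 1) * x powr (1 - p))"
      by (intro mult_left_mono) auto
    moreover have "\<tau> powr p * (x powr (\<alpha> - 1) * \<tau> powr (1 - p)) = \<tau> * x powr (\<alpha> - 1)"
      by (subst (3) split_\<tau>) simp
    ultimately have J: "\<tau> * x powr (\<alpha> - 1) \<le> ?R" unfolding split_x by simp
    have "convergence_rate \<alpha> r \<tau> x = ?R" using 3 by (simp add: convergence_rate_def p1(1))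
    then show ?thesis using I J p1(2) by (simp add: algebra_simps)
  qed
qed

text \<open>For \<open>(2 - \<alpha>) / r \<le> \<alpha>\<close> the target rate \<open>t powr (\<alpha> - p)\<close> is nondecreasing, so it is itself a barrier by
\<open>l1_sum_monotone_lower\<close>. Otherwise the plateau barriers apply. Capping \<open>p\<close> at \<open>1 + \<alpha> / 2\<close> loses nothing:
for \<open>r < 2 - \<alpha>\<close> every \<open>p > 1\<close> yields the same rate, and consistency requires \<open>p < 1 + \<alpha>\<close>.\<close>

lemma stability_rate:
  fixes \<alpha> r L :: real
  assumes \<alpha>: "0 < \<alpha>" "\<alpha> < 1" and r: "1 \<le> r" and L: "1 \<le> L"
  obtains p D :: real where "p \<le> (2 - \<alpha>) / r" "p < \<alpha> + 1" "0 < D"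
    "\<And>T N t V C m. is_mesh T N t \<Longrightarrow>
       (\<And>j. 2 \<le> j \<Longrightarrow> j \<le> N \<Longrightarrow> t j - t (j - 1) \<le> L * graded_step r (t 1) (t (j - 1))) \<Longrightarrow>
       V 0 = 0 \<Longrightarrow> 0 \<le> C \<Longrightarrow>
       (\<And>m. 1 \<le> m \<Longrightarrow> m \<le> N \<Longrightarrow> \<bar>l1_sum \<alpha> t V m\<bar> \<le> C * (t 1 / t m) powr p) \<Longrightarrow>
       1 \<le> m \<Longrightarrow> m \<le> N \<Longrightarrow> \<bar>V m\<bar> \<le> D * C * convergence_rate \<alpha> r (t 1) (t m)"
proof (cases "(2 - \<alpha>) / r \<le> \<alpha>")
  case True
  let ?p = "(2 - \<alpha>) / r"
  have "?p < \<alpha> + 1" using True by simp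
  have r2: "2 - \<alpha> < r"
  proof (rule ccontr)
    assume "\<not> 2 - \<alpha> < r"
    then have "1 \<le> ?p" using r by (simp add: le_divide_eq)
    then show False using True \<alpha> by simp
  qed
  have bound: "\<bar>V m\<bar> \<le> 1 * C * convergence_rate \<alpha> r (t 1) (t m)"
    if mesh: "is_mesh T N t" and V0: "V 0 = 0" and C: "0 \<le> C"
      and V: "\<And>m. 1 \<le> m \<Longrightarrow> m \<le> N \<Longrightarrow> \<bar>l1_sum \<alpha> t V m\<bar> \<le> C * (t 1 / t m) powr ?p"
      and m: "1 \<le> m" "m \<le> N" for T C :: real and N m :: nat and t V :: "nat \<Rightarrow> real"
  proof -
    define B where "B = (\<lambda>j::nat. if j = 0 then 0 else C * (t 1 powr ?p * t j powr (\<alpha> - ?p)))"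
    have pos: "0 < t n" if "1 \<le> n" "n \<le> N" for n using mesh_pos[OF mesh that] .
    have "\<bar>V m\<bar> \<le> B m"
    proof (rule l1_comparison[OF \<alpha> mesh, where V = V and B = B])
      fix n assume n: "1 \<le> n" "n \<le> N"
      have "(t 1 / t n) powr ?p = t 1 powr ?p * t n powr (- ?p)"
        using ratio_powr[OF pos[of 1] pos[OF n], of ?p] n by simp
      also have "t n powr (- ?p) = t n powr (-\<alpha>) * t n powr (\<alpha> - ?p)" by (simp flip: powr_add)
      finally have "C * (t 1 / t n) powr ?p = t n powr (-\<alpha>) * (B n - B 0)"
        using n by (simp add: B_def)
      also have "\<dots> \<le> l1_sum \<alpha> t B n"
      proof (rule l1_sum_monotone_lower[OF \<alpha> mesh n(2)])
        fix j assume j: "1 \<le> j" "j \<le> n"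
        show "B (j - 1) \<le> B j"
        proof (cases "j = 1")
          case False
          then have "0 < t (j - 1)" using pos[of "j - 1"] j n by simp
          then have "t (j - 1) powr (\<alpha> - ?p) \<le> t j powr (\<alpha> - ?p)"
            using mesh_le[OF mesh, of "j - 1" j] True j n by (intro powr_mono2) auto
          then show ?thesis using False j C by (auto simp: B_def intro!: mult_left_mono)
        qed (use C in \<open>simp add: B_def\<close>)
      qed
      finally show "\<bar>l1_sum \<alpha> t V n\<bar> \<le> l1_sum \<alpha> t B n" using V[OF n] by simp
    qed (use V0 m in \<open>simp_all add: B_def\<close>)
    then show ?thesis using m r2 by (simp add: B_def convergence_rate_def)
  qed
  show ?thesis
  proof (rule that[of ?p 1])
    fix T C :: real and N m :: nat and t V :: "nat \<Rightarrow> real"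
    assume "is_mesh T N t" "V 0 = 0" "0 \<le> C" "1 \<le> m" "m \<le> N"
      "\<And>m. 1 \<le> m \<Longrightarrow> m \<le> N \<Longrightarrow> \<bar>l1_sum \<alpha> t V m\<bar> \<le> C * (t 1 / t m) powr ?p"
    then show "\<bar>V m\<bar> \<le> 1 * C * convergence_rate \<alpha> r (t 1) (t m)" by (intro bound)
  qed (use \<open>?p < \<alpha> + 1\<close> in simp_all)
next
  case False
  define p where "p = min (1 + \<alpha> / 2) ((2 - \<alpha>) / r)"
  have p: "\<alpha> < p" "p \<le> (2 - \<alpha>) / r" "p < \<alpha> + 1" using False \<alpha> by (auto simp: p_def)
  let ?C = "16 * L\<^sup>2 * (1 + L) ^ 3 * (1 / (2 / r - \<alpha>) + (1 / \<alpha> + 1 / (1 - \<alpha>)))"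
  obtain k0 where k0: "2 \<le> k0" "?C * (1 / k0) powr \<alpha> \<le> (1 - \<alpha>) / 2"
  proof -
    have "((\<lambda>k. ?C * (1 / k) powr \<alpha>) \<longlongrightarrow> ?C * 0) at_top"
    proof (rule tendsto_mult_left)
      have "((\<lambda>k::real. k powr (-\<alpha>)) \<longlongrightarrow> 0) at_top"
        using \<alpha> by (intro tendsto_neg_powr filterlim_ident) auto
      moreover have "eventually (\<lambda>k::real. k powr (-\<alpha>) = (1 / k) powr \<alpha>) at_top"
        using eventually_gt_at_top[of 0] by eventually_elim (simp add: powr_divide powr_minus_divide)
      ultimately show "((\<lambda>k::real. (1 / k) powr \<alpha>) \<longlongrightarrow> 0) at_top" by (rule Lim_transform_eventually)
    qed
    then have "eventually (\<lambda>k. ?C * (1 / k) powr \<alpha> < (1 - \<alpha>) / 2) at_top"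
      using \<alpha> by (intro order_tendstoD(2)) auto
    then have "eventually (\<lambda>k. ?C * (1 / k) powr \<alpha> < (1 - \<alpha>) / 2 \<and> 2 \<le> k) at_top"
      using eventually_ge_at_top[of 2] by eventually_elim simp
    then obtain k where "?C * (1 / k) powr \<alpha> < (1 - \<alpha>) / 2 \<and> 2 \<le> k"
      using eventually_happens'[OF trivial_limit_at_top_linorder] by blast
    then show ?thesis using that[of k] by simp
  qed
  let ?c = "8 * k0 * (1 + L) / (1 - \<alpha>)" and ?d = "1 + 1 / \<bar>1 - p\<bar> + 1 / (p - \<alpha>)"
  have c: "0 < ?c" "0 < ?d" using k0 L \<alpha> p by (auto simp: add_pos_nonneg)
  have bound: "\<bar>V m\<bar> \<le> ?c * ?d * C * convergence_rate \<alpha> r (t 1) (t m)"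
    if mesh: "is_mesh T N t"
      and width: "\<And>j. 2 \<le> j \<Longrightarrow> j \<le> N \<Longrightarrow> t j - t (j - 1) \<le> L * graded_step r (t 1) (t (j - 1))"
      and V0: "V 0 = 0" and C: "0 \<le> C"
      and V: "\<And>m. 1 \<le> m \<Longrightarrow> m \<le> N \<Longrightarrow> \<bar>l1_sum \<alpha> t V m\<bar> \<le> C * (t 1 / t m) powr p"
      and m: "1 \<le> m" "m \<le> N" for T C :: real and N m :: nat and t V :: "nat \<Rightarrow> real"
  proof -
    have \<tau>: "0 < t 1" "t 1 \<le> t m" using mesh_pos[OF mesh, of 1] mesh_le[OF mesh, of 1 m] m by auto
    have "\<bar>V m\<bar> \<le> ?c * C *
           (t 1 * t m powr (\<alpha> - 1)
            + t 1 powr p * t m powr (\<alpha> - 1) * integral {t 1..t m} (\<lambda>s. s powr (- p))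
            + t 1 powr p * t m powr (\<alpha> - p) / (p - \<alpha>))"
      using stability[OF \<alpha> r L C _ p(1) k0 mesh width V0 V m] False by simp
    also have "\<dots> \<le> ?c * C * (?d * convergence_rate \<alpha> r (t 1) (t m))"
      by (rule mult_left_mono[OF barrier_bound_le_convergence_rate[OF \<alpha> r \<tau> p(1) p_def]
            mult_nonneg_nonneg[OF less_imp_le[OF c(1)] C]])
    finally show ?thesis by (simp add: mult_ac)
  qed
  show ?thesis
  proof (rule that[of p "?c * ?d"])
    fix T C :: real and N m :: nat and t V :: "nat \<Rightarrow> real"
    assume "is_mesh T N t" "V 0 = 0" "0 \<le> C" "1 \<le> m" "m \<le> N"
      "\<And>j. 2 \<le> j \<Longrightarrow> j \<le> N \<Longrightarrow> t j - t (j - 1) \<le> L * graded_step r (t 1) (t (j - 1))"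
      "\<And>m. 1 \<le> m \<Longrightarrow> m \<le> N \<Longrightarrow> \<bar>l1_sum \<alpha> t V m\<bar> \<le> C * (t 1 / t m) powr p"
    then show "\<bar>V m\<bar> \<le> ?c * ?d * C * convergence_rate \<alpha> r (t 1) (t m)" by (intro bound)
  qed (fact p(2), fact p(3), rule mult_pos_pos[OF c])
qed

section \<open>The error bound\<close>

text \<open>The last claim: let \<open>{t' (i - 1)..t' i}\<close> be the interval of the submesh that contains \<open>t j\<close>. Since \<open>t' (i - 1)\<close>
is also a node of the fine mesh, it is at most \<open>t (j - 1)\<close>, so the fine interval is contained in the
coarse one. As the first nodes agree, \<open>i \<ge> 2\<close>, and the endpoints of such an interval are comparable.\<close>

lemma admissible_mesh_graded:
  fixes K T r :: real
  assumes adm: "admissible_mesh K T r M N t" and r: "1 \<le> r"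
  shows "1 \<le> K" "t 1 \<le> K * real M powr (- r)" "1 \<le> M"
    and "\<And>j. 2 \<le> j \<Longrightarrow> j \<le> N \<Longrightarrow> t j - t (j - 1) \<le> (K ^ 3 * 2 powr r) * graded_step r (t 1) (t (j - 1))"
proof -
  have mesh: "is_mesh T N t" using adm by (simp add: admissible_mesh_def)
  obtain t' where t': "quasi_graded K T r M t'" "t' ` {..M} \<subseteq> t ` {..N}" "t' 1 = t 1"
    using adm unfolding admissible_mesh_def by blast
  have mesh': "is_mesh T M t'" using t' by (simp add: quasi_graded_def)
  show M: "1 \<le> M" using mesh' by (simp add: is_mesh_def)
  have \<tau>: "0 < t 1" using mesh_pos[OF mesh', of 1] t' M by simp
  have node: "t' i \<le> K * (t 1 * real i powr r)" "t 1 * real i powr r \<le> K * t' i"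
      "t' i - t' (i - 1) \<le> K * (t 1 powr (1 / r) * t' i powr (1 - 1 / r))" if "i \<in> {1..M}" for i
    using t' that by (auto simp: quasi_graded_def simeq_def)
  show "t 1 \<le> K * real M powr (- r)" using t' by (simp add: quasi_graded_def simeq_def)
  have "t 1 \<le> K * t 1" using node(1)[of 1] M t' by simp
  then show K: "1 \<le> K" using \<tau> by simp
  fix j assume j: "2 \<le> j" "j \<le> N"
  define i where "i = (LEAST i. t j \<le> t' i)"
  have ex: "t j \<le> t' M" using mesh_le[OF mesh j(2)] mesh mesh' by (simp add: is_mesh_def)
  have i: "t j \<le> t' i" "i \<le> M"
    using LeastI[of "\<lambda>i. t j \<le> t' i", OF ex] Least_le[of "\<lambda>i. t j \<le> t' i", OF ex] by (auto simp: i_def)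
  have "t 1 < t j" using mesh_less[OF mesh, of 1 j] j by simp
  moreover have "t' 0 = 0" using mesh' by (simp add: is_mesh_def)
  ultimately have "i \<noteq> 0" "i \<noteq> 1" using i(1) t'(3) \<tau> by (metis leD less_trans)+
  then have i2: "2 \<le> i" by simp
  have prev: "t' (i - 1) < t j"
    using not_less_Least[of "i - 1" "\<lambda>i. t j \<le> t' i"] i2 by (auto simp: i_def)
  have prev_le: "t' (i - 1) \<le> t (j - 1)"
  proof -
    have "t' (i - 1) \<in> t ` {..N}" using t'(2) i by auto
    then obtain n where n: "n \<le> N" "t' (i - 1) = t n" by auto
    have "n < j"
    proof (rule ccontr)
      assume "\<not> n < j"
      then have "t j \<le> t n" using mesh_le[OF mesh, of j n] n by simp
      then show False using prev n by simp
    qed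
    then show ?thesis using mesh_le[OF mesh, of n "j - 1"] n j by simp
  qed
  let ?Q = "K\<^sup>2 * 2 powr r"
  have Q: "1 \<le> ?Q"
  proof -
    have "1 * 1 \<le> ?Q" using K r by (intro mult_mono ge_one_powr_ge_zero one_le_power) auto
    then show ?thesis by simp
  qed
  have tp: "0 < t (j - 1)" using mesh_pos[OF mesh, of "j - 1"] j by simp
  have up: "t' i \<le> ?Q * t (j - 1)"
  proof -
    have "real i powr r \<le> (2 * real (i - 1)) powr r" using i2 r by (intro powr_mono2) auto
    also have "\<dots> = 2 powr r * real (i - 1) powr r" by (simp add: powr_mult)
    finally have "K * (t 1 * real i powr r) \<le> K * (t 1 * (2 powr r * real (i - 1) powr r))"
      using K \<tau> by (intro mult_left_mono) auto
    also have "\<dots> = K * 2 powr r * (t 1 * real (i - 1) powr r)" by simp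
    also have "\<dots> \<le> K * 2 powr r * (K * t' (i - 1))"
    proof (intro mult_left_mono)
      have "i - 1 \<in> {1..M}" using i2 i by auto
      then show "t 1 * real (i - 1) powr r \<le> K * t' (i - 1)" by (rule node(2))
    qed (use K in simp)
    also have "\<dots> \<le> K * 2 powr r * (K * t (j - 1))"
      using prev_le K by (intro mult_left_mono) auto
    finally show ?thesis using node(1)[of i] i i2 by (simp add: power2_eq_square mult_ac)
  qed
  have "t j - t (j - 1) \<le> t' i - t' (i - 1)" using i(1) prev_le by simp
  also have "\<dots> \<le> K * (t 1 powr (1 / r) * t' i powr (1 - 1 / r))" using node(3)[of i] i i2 by simp
  also have "\<dots> \<le> K * (t 1 powr (1 / r) * (?Q * t (j - 1) powr (1 - 1 / r)))"
  proof -
    have "t' i powr (1 - 1 / r) \<le> (?Q * t (j - 1)) powr (1 - 1 / r)"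
      using up r mesh_pos[OF mesh', of i] i i2 by (intro powr_mono2) auto
    also have "\<dots> = ?Q powr (1 - 1 / r) * t (j - 1) powr (1 - 1 / r)"
      using Q tp by (intro powr_mult)
    also have "\<dots> \<le> ?Q powr 1 * t (j - 1) powr (1 - 1 / r)"
      using Q r by (intro mult_right_mono powr_mono) auto
    finally have "t' i powr (1 - 1 / r) \<le> ?Q * t (j - 1) powr (1 - 1 / r)" using Q by simp
    then show ?thesis using K by (intro mult_left_mono) auto
  qed
  finally show "t j - t (j - 1) \<le> (K ^ 3 * 2 powr r) * graded_step r (t 1) (t (j - 1))"
    by (simp add: graded_step_def power2_eq_square power3_eq_cube mult_ac)
qed

lemma convergence_rate_le_err_bound:
  fixes \<alpha> r \<tau> x K :: real
  assumes \<alpha>: "0 < \<alpha>" "\<alpha> < 1" and r: "1 \<le> r" and \<tau>: "0 < \<tau>" "\<tau> \<le> x"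
    and K: "1 \<le> K" "\<tau> \<le> K * real M powr (- r)" and M: "1 \<le> M"
  shows "convergence_rate \<alpha> r \<tau> x \<le> K * err_bound \<alpha> r M \<tau> x"
proof -
  consider "r < 2 - \<alpha>" | "r = 2 - \<alpha>" | "2 - \<alpha> < r" by linarith
  then show ?thesis
  proof cases
    case 1
    then show ?thesis using mult_right_mono[OF K(2), of "x powr (\<alpha> - 1)"]
      by (simp add: convergence_rate_def err_bound_def mult_ac)
  next
    case 2
    have "0 \<le> ln (x / \<tau>)" using \<tau> by simp
    then have "\<tau> * (x powr (\<alpha> - 1) * (1 + ln (x / \<tau>))) \<le> (K * real M powr (- r)) * (x powr (\<alpha> - 1) * (1 + ln (x / \<tau>)))"
      by (intro mult_right_mono K(2)) auto
    then show ?thesis using 2 by (simp add: convergence_rate_def err_bound_def mult_ac)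
  next
    case 3
    let ?p = "(2 - \<alpha>) / r"
    have p: "0 < ?p" "?p \<le> 1" using 3 \<alpha> r by (auto simp: divide_le_eq_1)
    have "\<tau> powr ?p \<le> (K * real M powr (- r)) powr ?p"
      using \<tau> K p by (intro powr_mono2) auto
    also have "\<dots> = K powr ?p * real M powr (\<alpha> - 2)"
      using K r by (simp add: powr_mult powr_powr)
    also have "\<dots> \<le> K powr 1 * real M powr (\<alpha> - 2)"
      using K p by (intro mult_right_mono powr_mono) auto
    finally have "\<tau> powr ?p \<le> K * real M powr (\<alpha> - 2)" using K by simp
    then have "\<tau> powr ?p * x powr (\<alpha> - ?p) \<le> K * real M powr (\<alpha> - 2) * x powr (\<alpha> - ?p)"
      by (rule mult_right_mono) simp
    then show ?thesis using 3 by (simp add: convergence_rate_def err_bound_def mult.assoc)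
  qed
qed

theorem theorem3p1:
  fixes \<alpha> T r u0 K Ku :: real and u u1 u2 f :: "real \<Rightarrow> real"
  assumes alpha: "0 < \<alpha>" "\<alpha> < 1" and T: "0 < T" and r: "1 \<le> r"
    and u_cont: "continuous_on {0..T} u"
    and u_deriv1: "\<And>t. t \<in> {0<..T} \<Longrightarrow> (u has_real_derivative u1 t) (at t within {0<..T})"
    and u_deriv2: "\<And>t. t \<in> {0<..T} \<Longrightarrow> (u1 has_real_derivative u2 t) (at t within {0<..T})"
    and u2_cont: "continuous_on {0<..T} u2"
    and u1_bound: "\<And>t. t \<in> {0<..T} \<Longrightarrow> \<bar>u1 t\<bar> \<le> Ku * (1 + t powr (\<alpha> - 1))"
    and u2_bound: "\<And>t. t \<in> {0<..T} \<Longrightarrow> \<bar>u2 t\<bar> \<le> Ku * (1 + t powr (\<alpha> - 2))"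
    and u_eq: "\<And>t. t \<in> {0<..T} \<Longrightarrow> caputo \<alpha> u t = f t"
    and u_init: "u 0 = u0"
  shows "\<exists>C>0. \<forall>(M::nat) (N::nat) (t::nat \<Rightarrow> real) (U::nat \<Rightarrow> real).
           admissible_mesh K T r M N t \<longrightarrow>
           (\<forall>m\<in>{1..N}. L1_op \<alpha> t U m = f (t m)) \<longrightarrow>
           U 0 = u0 \<longrightarrow>
           (\<forall>m\<in>{1..N}. \<bar>u (t m) - U m\<bar> \<le> C * err_bound \<alpha> r M (t 1) (t m))"
proof -
  define K' L where "K' = max 1 K" and "L = K' ^ 3 * 2 powr r"
  have K': "1 \<le> K'" by (simp add: K'_def)
  have "1 * 1 \<le> L" unfolding L_def
    using K' r by (intro mult_mono ge_one_powr_ge_zero one_le_power) auto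
  then have L: "1 \<le> L" by simp
  obtain p D where p: "p \<le> (2 - \<alpha>) / r" "p < \<alpha> + 1" and D: "0 < D"
    and stable: "\<And>T N t V C m. is_mesh T N t \<Longrightarrow>
       (\<And>j. 2 \<le> j \<Longrightarrow> j \<le> N \<Longrightarrow> t j - t (j - 1) \<le> L * graded_step r (t 1) (t (j - 1))) \<Longrightarrow>
       V 0 = 0 \<Longrightarrow> 0 \<le> C \<Longrightarrow>
       (\<And>m. 1 \<le> m \<Longrightarrow> m \<le> N \<Longrightarrow> \<bar>l1_sum \<alpha> t V m\<bar> \<le> C * (t 1 / t m) powr p) \<Longrightarrow>
       1 \<le> m \<Longrightarrow> m \<le> N \<Longrightarrow> \<bar>V m\<bar> \<le> D * C * convergence_rate \<alpha> r (t 1) (t m)"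
    using stability_rate[OF alpha r L] by blast
  have Ku: "0 \<le> Ku"
  proof -
    have "0 \<le> Ku * (1 + T powr (\<alpha> - 1))" using u1_bound[of T] T by force
    moreover have "0 < 1 + T powr (\<alpha> - 1)" using T by (simp add: add_pos_pos)
    ultimately show ?thesis by (simp add: zero_le_mult_iff)
  qed
  define Cu where "Cu = Ku * (1 + T powr (1 - \<alpha>) + T powr (2 - \<alpha>))"
  have Cu: "0 \<le> Cu" using Ku by (simp add: Cu_def)
  have d1: "(u has_real_derivative u1 s) (at s)" and d2: "(u1 has_real_derivative u2 s) (at s)"
    if s: "s \<in> {0<..<T}" for s
  proof -
    have "at s within {0<..T} = at s"
      using s by (intro at_within_interior interiorI[of "{0<..<T}"]) auto
    then show "(u has_real_derivative u1 s) (at s)" "(u1 has_real_derivative u2 s) (at s)"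
      using u_deriv1[of s] u_deriv2[of s] s by auto
  qed
  have one_le: "1 \<le> T powr q * s powr (- q)" if "s \<in> {0<..<T}" "0 \<le> q" for s q
    using that ratio_powr[of T s q] T by (simp add: ge_one_powr_ge_zero)
  have b1: "\<bar>u1 s\<bar> \<le> Cu * s powr (\<alpha> - 1)" if s: "s \<in> {0<..<T}" for s
  proof -
    have "\<bar>u1 s\<bar> \<le> Ku * (T powr (1 - \<alpha>) * s powr (\<alpha> - 1) + s powr (\<alpha> - 1))"
      using u1_bound[of s] one_le[OF s, of "1 - \<alpha>"] alpha s Ku
      by (smt (verit, best) greaterThanAtMost_iff greaterThanLessThan_iff mult_left_mono)
    also have "\<dots> = Ku * (1 + T powr (1 - \<alpha>)) * s powr (\<alpha> - 1)" by (simp add: algebra_simps)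
    also have "\<dots> \<le> Cu * s powr (\<alpha> - 1)"
      unfolding Cu_def using Ku by (intro mult_right_mono mult_left_mono) auto
    finally show ?thesis .
  qed
  have b2: "\<bar>u2 s\<bar> \<le> Cu * s powr (\<alpha> - 2)" if s: "s \<in> {0<..<T}" for s
  proof -
    have "\<bar>u2 s\<bar> \<le> Ku * (T powr (2 - \<alpha>) * s powr (\<alpha> - 2) + s powr (\<alpha> - 2))"
      using u2_bound[of s] one_le[OF s, of "2 - \<alpha>"] alpha s Ku
      by (smt (verit, best) greaterThanAtMost_iff greaterThanLessThan_iff mult_left_mono)
    also have "\<dots> = Ku * (1 + T powr (2 - \<alpha>)) * s powr (\<alpha> - 2)" by (simp add: algebra_simps)
    also have "\<dots> \<le> Cu * s powr (\<alpha> - 2)"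
      unfolding Cu_def using Ku by (intro mult_right_mono mult_left_mono) auto
    finally show ?thesis .
  qed
  have cont1: "continuous_on {0<..<T} u1"
    using d2 by (intro continuous_at_imp_continuous_on ballI DERIV_isCont)
  define E where "E = 72 * Cu * (1 + (1 / \<alpha> + 1 / (1 - \<alpha>)))
         + 8 * Cu * L\<^sup>2 * (1 + L) ^ 3 * (1 / (\<alpha> + 1 - p) + (1 / \<alpha> + 1 / (1 - \<alpha>)))"
  have E: "0 \<le> E" unfolding E_def using Cu L alpha p
    by (intro add_nonneg_nonneg mult_nonneg_nonneg) auto
  have Gam: "0 < Gamma (1 - \<alpha>)" using alpha by (intro Gamma_real_pos) auto
  have "\<bar>u (t m) - U m\<bar> \<le> (D * E * K' + 1) * err_bound \<alpha> r M (t 1) (t m)"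
    if adm: "admissible_mesh K T r M N t" and U: "\<forall>m\<in>{1..N}. L1_op \<alpha> t U m = f (t m)"
      and U0: "U 0 = u0" and m: "m \<in> {1..N}" for M N m :: nat and t U :: "nat \<Rightarrow> real"
  proof -
    note graded = admissible_mesh_graded[OF adm r]
    have K'K: "K' = K" using graded(1) by (simp add: K'_def)
    have mesh: "is_mesh T N t" using adm by (simp add: admissible_mesh_def)
    have width: "t j - t (j - 1) \<le> L * graded_step r (t 1) (t (j - 1))" if "2 \<le> j" "j \<le> N" for j
      using graded(4)[OF that] by (simp add: L_def K'K)
    have t: "t 0 = 0" "t N = T" using mesh by (auto simp: is_mesh_def)
    let ?e = "\<lambda>j. u (t j) - U j"
    \<comment> \<open>The L1 operator of \<open>U\<close> is the Caputo derivative of \<open>u\<close>, so that of the error is the consistency error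
        of \<open>u\<close>.\<close>
    have cons: "\<bar>l1_sum \<alpha> t ?e n\<bar> \<le> E * (t 1 / t n) powr p" if n: "1 \<le> n" "n \<le> N" for n
    proof -
      have tn: "0 < t n" "t n \<le> T" using mesh_pos[OF mesh n] mesh_le[OF mesh n(2)] t by auto
      have "integral {0..t n} (\<lambda>s. (t n - s) powr (-\<alpha>) * deriv u s)
          = integral {0..t n} (\<lambda>s. (t n - s) powr (-\<alpha>) * u1 s)"
      proof (rule integral_spike[of "{0, t n}"])
        fix s assume s: "s \<in> {0..t n} - {0, t n}"
        then have "deriv u s = u1 s" using tn by (intro DERIV_imp_deriv d1) auto
        then show "(t n - s) powr (-\<alpha>) * u1 s = (t n - s) powr (-\<alpha>) * deriv u s" by simp
      qed simp
      then have "l1_sum \<alpha> t U n / Gamma (1 - \<alpha>)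
          = integral {0..t n} (\<lambda>s. (t n - s) powr (-\<alpha>) * u1 s) / Gamma (1 - \<alpha>)"
        using U[rule_format, of n] u_eq[of "t n"] n tn
        by (simp add: L1_op_eq_l1_sum caputo_def)
      then have "l1_sum \<alpha> t U n = integral {0..t n} (\<lambda>s. (t n - s) powr (-\<alpha>) * u1 s)"
        using Gam unfolding divide_cancel_right by simp
      then show ?thesis
        using consistency_error[OF alpha r L p u_cont cont1 d1 d2 b1 b2 mesh n width]
        by (simp add: l1_sum_diff E_def)
    qed
    have m': "1 \<le> m" "m \<le> N" using m by auto
    have \<tau>: "0 < t 1" "t 1 \<le> t m" using mesh_pos[OF mesh, of 1] mesh_le[OF mesh, of 1 m] m' by auto
    have "?e 0 = 0" using U0 u_init t by simp
    then have "\<bar>?e m\<bar> \<le> D * E * convergence_rate \<alpha> r (t 1) (t m)"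
      using stable[OF mesh width _ E cons m'] by blast
    also have "\<dots> \<le> D * E * (K * err_bound \<alpha> r M (t 1) (t m))"
      using convergence_rate_le_err_bound[OF alpha r \<tau> graded(1,2,3)] D E
      by (intro mult_left_mono) auto
    also have "\<dots> = D * E * K' * err_bound \<alpha> r M (t 1) (t m)" by (simp add: K'K)
    \<comment> \<open>Adding \<open>1\<close> keeps the constant positive when \<open>E\<close> vanishes.\<close>
    also have "\<dots> \<le> (D * E * K' + 1) * err_bound \<alpha> r M (t 1) (t m)"
    proof -
      have "0 \<le> ln (t m / t 1)" using \<tau> by simp
      then have "0 \<le> err_bound \<alpha> r M (t 1) (t m)" by (simp add: err_bound_def)
      then show ?thesis by (intro mult_right_mono) auto
    qed
    finally show ?thesis .
  qed
  moreover have "0 < D * E * K' + 1" using D E K' by (simp add: add_nonneg_pos)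
  ultimately show ?thesis by blast
qed

end
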